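(* There is an absolute constant $K>0$ such that the following holds for $k\in\{1,2\}$. Let $n\ge 2$, $V=\{0,1\}^n$, $\mu$ uniform measure on $V$, $\beta=\log_2(3/2)$, $\varepsilon>0$, and let $(A,B,W)$ be a partition of $V$ with $(1-\varepsilon)2^{-k}\le \mu(A)\le(1+\varepsilon)2^{-k}$, $\mu(W)\le \varepsilon n^{-\beta}$, and \[ |\nabla(A,B)|<(1+\varepsilon)k2^{n-k}. \] Then there is $I\subseteq[n]$ with $|I|=k$ such that $|\nabla_i A|\ge (1-K\varepsilon)2^{n-k}$ for all $i\in I$. Furthermore, there is a codimension-$k$ subcube $C$ with $\mu(C\,\Delta\,A)\le K\varepsilon$.
   Context: $V=\{0,1\}^n$ is the vertex set of the Hamming cube $Q_n$ (vertices adjacent iff they differ in exactly one coordinate). For $x\in V$, $x^i$ is obtained from $x$ by flipping coordinate $i$. For disjoint $A,B\subseteq V$, $\nabla(A,B)$ is the set of pairs $(x,y)$ with $x\in A$, $y\in B$, $x,y$ adjacent. $\nabla_i A=\{(x,x^i): x\in A,\ x^i\notin A\}$. A codimension-$k$ subcube is a set $\{x\in V: x_i=z_i\ \forall i\in I\}$ with $|I|=k$, $z\in\{0,1\}^I$. *)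

theory Defs
  imports Complex_Main
begin

text \<open>Vertices of the Hamming cube Q_n: 0/1 vectors indexed by coordinates 0..n-1,
  encoded as boolean functions on nat that vanish outside [0,n).\<close>

definition cube :: "nat \<Rightarrow> (nat \<Rightarrow> bool) set" where
  "cube n = {x. \<forall>i. n \<le> i \<longrightarrow> \<not> x i}"

definition flip :: "(nat \<Rightarrow> bool) \<Rightarrow> nat \<Rightarrow> (nat \<Rightarrow> bool)" where
  "flip x i = x(i := \<not> x i)"

definition adjacent :: "(nat \<Rightarrow> bool) \<Rightarrow> (nat \<Rightarrow> bool) \<Rightarrow> bool" where
  "adjacent x y \<longleftrightarrow> card {i. x i \<noteq> y i} = 1"

definition mu :: "nat \<Rightarrow> (nat \<Rightarrow> bool) set \<Rightarrow> real" where
  "mu n S = real (card S) / 2 ^ n"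

definition edge_boundary ::
  "(nat \<Rightarrow> bool) set \<Rightarrow> (nat \<Rightarrow> bool) set \<Rightarrow> ((nat \<Rightarrow> bool) \<times> (nat \<Rightarrow> bool)) set" where
  "edge_boundary A B = {(x, y). x \<in> A \<and> y \<in> B \<and> adjacent x y}"

definition dir_boundary ::
  "(nat \<Rightarrow> bool) set \<Rightarrow> nat \<Rightarrow> ((nat \<Rightarrow> bool) \<times> (nat \<Rightarrow> bool)) set" where
  "dir_boundary A i = {(x, flip x i) | x. x \<in> A \<and> flip x i \<notin> A}"

definition subcube :: "nat \<Rightarrow> nat set \<Rightarrow> (nat \<Rightarrow> bool) \<Rightarrow> (nat \<Rightarrow> bool) set" where
  "subcube n I z = {x \<in> cube n. \<forall>i\<in>I. x i = z i}"

definition is_codim_subcube :: "nat \<Rightarrow> nat \<Rightarrow> (nat \<Rightarrow> bool) set \<Rightarrow> bool" where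
  "is_codim_subcube n k C \<longleftrightarrow>
     (\<exists>I z. I \<subseteq> {0..<n} \<and> card I = k \<and> C = subcube n I z)"

end

theory Submission
  imports Defs "HOL-Analysis.Convex" "HOL-Library.Indicator_Function"
begin

text \<open>
  Put \<open>S = A \<union> W\<close> and let \<open>h x\<close> be the number of neighbours of \<open>x \<in> S\<close> outside \<open>S\<close>. Induction on the
  dimension gives \<open>E (1\<^sub>S h\<^sup>\<beta>) \<ge> 2 \<mu>(S) (1 - \<mu>(S))\<close>, with equality for subcubes of codimension 1 and 2.
  The vertices of \<open>W\<close> contribute at most \<open>n\<^sup>\<beta> \<mu>(W) \<le> \<epsilon>\<close>, so by strict concavity of \<open>t\<^sup>\<beta>\<close> the edge
  bound forces \<open>h = k\<close> on all but \<open>O(\<epsilon>)\<close> of \<open>S\<close>.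

  The same inequality holds inside the subcubes in which only the coordinates in a set \<open>T\<close> vary.
  Averaged over all \<open>T\<close>, it compares the known \<open>h\<close> with the noise stability of \<open>1\<^sub>S\<close> and
  shows that the squared degree-one Fourier coefficients \<open>c\<^sub>i\<close> sum to at least \<open>2\<^bsup>-k-1\<^esup> - O(\<epsilon>)\<close>, which is
  also the largest possible value of the squared \<open>L\<^sup>2\<close> norm of the odd part of \<open>1\<^sub>S\<close>. Hence that odd part, whose values
  are \<open>0\<close> and \<open>\<plusminus>1/2\<close>, is nearly a linear form, and comparing fourth moments produces \<open>k\<close> coordinates
  whose \<open>c\<^sub>i\<close> is bounded away from \<open>0\<close>. For \<open>T\<close> the complement of \<open>{i}\<close> the inequality gives
  \<open>\<bar>c\<^sub>i\<bar> (1 - 2k \<bar>c\<^sub>i\<bar>) = O(\<epsilon>)\<close>, so these \<open>\<bar>c\<^sub>i\<bar>\<close> are \<open>2\<^bsup>-k\<^esup> - O(\<epsilon>)\<close>, and \<open>S\<close> nearly lies in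
  the corresponding half-cubes.
\<close>

section \<open>The exponent\<close>

definition beta :: real where
  "beta = log 2 (3/2)"

lemma two_powr_beta: "2 powr beta = 3/2"
  by (simp add: beta_def)

lemma beta_ge_half: "1/2 \<le> beta"
proof -
  have "sqrt 2 \<le> (3/2::real)"
    by (rule real_le_lsqrt) (auto simp: power2_eq_square)
  then have "2 powr (1/2) \<le> (2::real) powr beta"
    by (simp add: two_powr_beta powr_half_sqrt)
  then show ?thesis by simp
qed

text \<open>Compare fifth powers: \<open>(3/2) ^ 5 = 243/32\<close> stays below
  \<open>2 ^ 3\<close>.\<close>

lemma beta_le: "beta \<le> 3/5"
proof -
  have "(2 powr (3/5)) ^ 5 = (2::real) powr 3"
    by (simp add: powr_powr flip: powr_realpow)
  then have "(3/2::real) ^ 5 \<le> (2 powr (3/5)) ^ 5"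
    by (simp add: power_divide)
  then have "2 powr beta \<le> (2::real) powr (3/5)"
    unfolding two_powr_beta by (rule power_le_imp_le_base[of _ 4, unfolded Suc_numeral, simplified]) simp
  then show ?thesis by simp
qed

lemma powr_power_commute: "0 < x \<Longrightarrow> (x powr b) ^ n = (x ^ n) powr (b::real)"
  by (simp add: powr_powr mult.commute flip: powr_realpow)

text \<open>Rests on \<open>3 ^ 5 \<le> 2 ^ 8\<close>. The value 48/25 is exactly what
  \<open>powr_beta_gap_2\<close> can afford at \<open>h = 3\<close>.\<close>

lemma three_powr_beta: "3 powr beta \<le> 48/25"
proof -
  have "(3 powr beta) ^ 5 = ((3::real) ^ 5) powr beta"
    by (rule powr_power_commute) simp
  also have "\<dots> \<le> (2 ^ 8) powr beta"
    using beta_ge_half by (intro powr_mono2) auto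
  also have "\<dots> = (2 powr beta) ^ 8"
    by (rule powr_power_commute[symmetric]) simp
  also have "\<dots> \<le> (48/25) ^ 5"
    by (simp add: two_powr_beta power_divide)
  finally show ?thesis
    by (rule power_le_imp_le_base[of _ 4, unfolded Suc_numeral, simplified]) simp
qed

text \<open>The tangent line of a concave power at \<open>z\<close>, obtained from Young's
  inequality for \<open>x / z\<close> and 1.\<close>

lemma powr_le_tangent:
  fixes x z b :: real
  assumes "0 \<le> x" "0 < z" "0 \<le> b" "b \<le> 1"
  shows "x powr b \<le> z powr b * (1 + b * (x / z - 1))"
proof (cases "x = 0")
  case False
  have "(x / z) powr b * 1 powr (1 - b) \<le> b * (x / z) + (1 - b) * 1"
    using False assms by (intro Youngs_inequality_0) auto
  then have "z powr b * (x / z) powr b \<le> z powr b * (1 + b * (x / z - 1))"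
    by (intro mult_left_mono) (auto simp: algebra_simps)
  then show ?thesis using assms by (simp add: powr_divide)
qed (use assms in auto)

lemma powr_concave:
  fixes x y w b :: real
  assumes "0 \<le> x" "0 \<le> y" "0 \<le> w" "w \<le> 1" "0 \<le> b" "b \<le> 1" 
  shows "w * x powr b + (1 - w) * y powr b \<le> (w * x + (1 - w) * y) powr b"
proof (cases "w * x + (1 - w) * y = 0")
  case True
  then have "w * x = 0" "(1 - w) * y = 0"
    using assms by (smt (verit) mult_nonneg_nonneg)+
  then show ?thesis by auto
next
  case False
  define z where "z = w * x + (1 - w) * y"
  have z: "z > 0" using False assms by (simp add: z_def less_le)
  have "w * x powr b + (1 - w) * y powr b
      \<le> w * (z powr b * (1 + b * (x / z - 1))) + (1 - w) * (z powr b * (1 + b * (y / z - 1)))"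
    using assms z by (intro add_mono mult_left_mono powr_le_tangent) auto
  also have "\<dots> = z powr b * (1 + b * ((w * x + (1 - w) * y) / z - 1))"
    by (simp add: algebra_simps add_divide_distrib diff_divide_distrib)
  also have "\<dots> = z powr b" using z by (simp add: z_def[symmetric])
  finally show ?thesis by (simp add: z_def)
qed

text \<open>Concavity at the points \<open>h / w\<close> and \<open>1 / (1 - w)\<close> with weights
  \<open>w\<close> and \<open>1 - w\<close>, whose mean is \<open>h + 1\<close>. The weight stays
  free so that \<open>avg_bd_insert_ge\<close> can optimise it.\<close>

lemma Suc_powr_beta_ge:
  assumes "0 < w" "w < 1"
  shows "w powr (1 - beta) * real h powr beta + (1 - w) powr (1 - beta) \<le> real (Suc h) powr beta"
proof -
  have "w * (real h / w) powr beta + (1 - w) * (1 / (1 - w)) powr beta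
     \<le> (w * (real h / w) + (1 - w) * (1 / (1 - w))) powr beta"
    using assms beta_ge_half beta_le by (intro powr_concave) auto
  moreover have "w * (real h / w) powr beta = w powr (1 - beta) * real h powr beta"
    using assms by (simp add: powr_divide powr_diff)
  moreover have "(1 - w) * (1 / (1 - w)) powr beta = (1 - w) powr (1 - beta)"
    using assms by (simp add: powr_divide powr_diff)
  moreover have "w * (real h / w) + (1 - w) * (1 / (1 - w)) = real (Suc h)"
    using assms by simp
  ultimately show ?thesis by metis
qed

text \<open>For positive \<open>h\<close>, the weight 1/2 above gives
  \<open>3/4 * h powr beta + 3/4\<close>, which is enough because
  \<open>h powr beta \<ge> 1\<close>.\<close>

lemma Suc_powr_beta_ge_half: "1 + real h powr beta / 2 \<le> real (Suc h) powr beta"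
proof (cases h)
  case (Suc j)
  have *: "(1/2) powr (1 - beta) = (3/4::real)" "1 - 1/2 = (1/2::real)"
    by (simp_all add: powr_diff powr_divide two_powr_beta)
  have "3/4 * real h powr beta + 3/4 \<le> real (Suc h) powr beta"
    using Suc_powr_beta_ge[of "1/2" h, unfolded *] by simp
  moreover have "1 \<le> real h powr beta"
    using Suc beta_ge_half by (intro ge_one_powr_ge_zero) auto
  ultimately show ?thesis by simp
qed simp

text \<open>The chord of the power function over [1, 2] has slope 1/2, and
  \<open>beta \<ge> 1/2\<close> makes the square of \<open>s powr beta\<close> at most
  \<open>s\<close>.\<close>

lemma one_plus_powr_beta_ge:
  assumes "0 \<le> s" "s \<le> 1"
  shows "1 + (s powr beta)\<^sup>2 / 2 \<le> (1 + s) powr beta"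
proof -
  have "(s powr beta)\<^sup>2 = s powr (2 * beta)"
    by (simp add: power2_eq_square flip: powr_add)
  also have "\<dots> \<le> s powr 1"
    using assms beta_ge_half by (intro powr_mono') auto
  finally have "(s powr beta)\<^sup>2 \<le> s" using assms by simp
  moreover have "(1 - s) * 1 powr beta + (1 - (1 - s)) * 2 powr beta \<le> ((1 - s) * 1 + (1 - (1 - s)) * 2) powr beta"
    using assms beta_ge_half beta_le by (intro powr_concave) auto
  then have "1 + s / 2 \<le> (1 + s) powr beta"
    by (simp add: two_powr_beta algebra_simps)
  ultimately show ?thesis by simp
qed

section \<open>The isoperimetric inequality\<close>

definition xor_set :: "(nat \<Rightarrow> bool) \<Rightarrow> nat set \<Rightarrow> nat \<Rightarrow> bool" where
  "xor_set x U = (\<lambda>i. x i \<noteq> (i \<in> U))"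

lemma xor_set_empty [simp]: "xor_set x {} = x"
  by (simp add: xor_set_def)

lemma flip_flip [simp]: "flip (flip x i) i = x"
  by (auto simp: flip_def)

lemma xor_set_insert: "i \<notin> U \<Longrightarrow> xor_set x (insert i U) = xor_set (flip x i) U"
  by (auto simp: xor_set_def flip_def fun_eq_iff)

lemma xor_set_flip: "xor_set (flip x i) U = flip (xor_set x U) i"
  by (auto simp: xor_set_def flip_def fun_eq_iff)

text \<open>The conditional expectation of \<open>\<phi>\<close> given the coordinates outside a
  finite \<open>T\<close>: the mean over the subcube through \<open>x\<close> with free directions
  \<open>T\<close>.\<close>

definition avg :: "nat set \<Rightarrow> ((nat \<Rightarrow> bool) \<Rightarrow> real) \<Rightarrow> (nat \<Rightarrow> bool) \<Rightarrow> real" where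
  "avg T \<phi> x = (\<Sum>U\<in>Pow T. \<phi> (xor_set x U)) / 2 ^ card T"

lemma avg_empty [simp]: "avg {} \<phi> x = \<phi> x"
  by (simp add: avg_def)

lemma sum_Pow_insert:
  assumes "finite T" "i \<notin> T"
  shows "(\<Sum>U\<in>Pow (insert i T). F U) = (\<Sum>U\<in>Pow T. F U) + (\<Sum>U\<in>Pow T. F (insert i U) :: real)"
proof -
  have "inj_on (insert i) (Pow T)" using assms(2) by (auto simp: inj_on_def)
  then show ?thesis
    unfolding Pow_insert using assms
    by (subst sum.union_disjoint) (auto simp: sum.reindex)
qed

lemma avg_insert:
  assumes "finite T" "i \<notin> T"
  shows "avg (insert i T) \<phi> x = (avg T \<phi> x + avg T \<phi> (flip x i)) / 2"
proof -
  have "(\<Sum>U\<in>Pow T. \<phi> (xor_set x (insert i U))) = (\<Sum>U\<in>Pow T. \<phi> (xor_set (flip x i) U))"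
    using assms(2) by (intro sum.cong refl, subst xor_set_insert) auto
  then show ?thesis
    using assms by (simp add: avg_def sum_Pow_insert add_divide_distrib)
qed

lemma avg_flip: "avg T \<phi> (flip x i) = avg T (\<lambda>y. \<phi> (flip y i)) x"
  by (simp add: avg_def xor_set_flip)

lemma avg_add: "avg T (\<lambda>y. \<phi> y + \<psi> y) x = avg T \<phi> x + avg T \<psi> x"
  by (simp add: avg_def sum.distrib add_divide_distrib)

lemma avg_diff: "avg T (\<lambda>y. \<phi> y - \<psi> y) x = avg T \<phi> x - avg T \<psi> x"
  by (simp add: avg_def sum_subtractf diff_divide_distrib)

lemma avg_cmult: "avg T (\<lambda>y. c * \<phi> y) x = c * avg T \<phi> x"
  by (simp add: avg_def sum_distrib_left)

lemma avg_mono: "(\<And>y. \<phi> y \<le> \<psi> y) \<Longrightarrow> avg T \<phi> x \<le> avg T \<psi> x"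
  by (simp add: avg_def divide_right_mono sum_mono)

lemma avg_const: "finite T \<Longrightarrow> avg T (\<lambda>y. c) x = c"
  by (simp add: avg_def card_Pow)

section \<open>Boundary degrees and the induction on the dimension\<close>

definition out_deg :: "(nat \<Rightarrow> bool) set \<Rightarrow> nat set \<Rightarrow> (nat \<Rightarrow> bool) \<Rightarrow> nat" where
  "out_deg S T x = card {i \<in> T. flip x i \<notin> S}"

definition bd :: "(nat \<Rightarrow> bool) set \<Rightarrow> nat set \<Rightarrow> (nat \<Rightarrow> bool) \<Rightarrow> real" where
  "bd S T x = (if x \<in> S then real (out_deg S T x) powr beta else 0)"

lemma bd_nonneg: "0 \<le> bd S T x"
  by (simp add: bd_def)

lemma out_deg_insert:
  assumes "finite T" "i \<notin> T"
  shows "out_deg S (insert i T) x = (if flip x i \<in> S then out_deg S T x else Suc (out_deg S T x))"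
proof -
  have "{j \<in> insert i T. flip x j \<notin> S} =
      (if flip x i \<in> S then {j \<in> T. flip x j \<notin> S} else insert i {j \<in> T. flip x j \<notin> S})"
    by auto
  then show ?thesis using assms by (auto simp: out_deg_def)
qed

lemma avg_bd_insert_ge:
  fixes S x i T
  defines "f \<equiv> indicator S :: _ \<Rightarrow> real"
  defines "a0 \<equiv> avg T f x" and "a1 \<equiv> avg T f (flip x i)"
  assumes T: "finite T" "i \<notin> T" and le: "a1 \<le> a0"
    and IH: "2 * a0 * (1 - a0) \<le> avg T (bd S T) x"
  shows "2 * a0 * (1 - a0) + (a0 - a1)\<^sup>2 \<le> avg T (bd S (insert i T)) x"
proof -
  \<comment> \<open>Bounds \<open>(h + 1)\<^sup>\<beta> \<ge> l h\<^sup>\<beta> + c\<close> that are linear in \<open>h\<^sup>\<beta>\<close> survive averaging: \<open>l = 1/2, c = 1\<close> is exact at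
    \<open>h = 0, 1\<close> and handles \<open>u \<le> d\<close>; for \<open>d < u\<close> the pair comes from concavity, with the weight \<open>w\<close>
    chosen so that the total is \<open>(u\<^bsup>1/\<beta>\<^esup> + d\<^bsup>1/\<beta>\<^esup>)\<^sup>\<beta>\<close>.\<close>
  define u d where "u = 2 * a0 * (1 - a0)" and "d = a0 - a1"
  \<comment> \<open>\<open>Z\<close> marks the points of \<open>S\<close> whose degree grows by one
    when \<open>i\<close> joins \<open>T\<close>. Its mean is at least the density drop
    \<open>d\<close>.\<close>
  define Z :: "_ \<Rightarrow> real" where "Z = (\<lambda>y. if y \<in> S \<and> flip y i \<notin> S then 1 else 0)"
  have bd_ins: "bd S (insert i T) y =
      (if Z y = 1 then real (Suc (out_deg S T y)) powr beta else bd S T y)" for y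
    using T by (auto simp: bd_def Z_def out_deg_insert)
  have bd_Z: "Z y = 1 \<Longrightarrow> bd S T y = real (out_deg S T y) powr beta" for y
    by (auto simp: Z_def bd_def split: if_splits)
  have Z01: "Z y = 0 \<or> Z y = 1" for y by (simp add: Z_def)
  have "avg T (\<lambda>y. f y - f (flip y i)) x \<le> avg T Z x"
    by (intro avg_mono) (auto simp: f_def Z_def indicator_def)
  then have dZ: "d \<le> avg T Z x"
    by (simp add: avg_diff d_def a0_def a1_def avg_flip)
  have f01: "0 \<le> avg T f y \<and> avg T f y \<le> 1" for y
    using avg_mono[of "\<lambda>_. 0" f T y] avg_mono[of f "\<lambda>_. 1" T y] T
    by (auto simp: f_def avg_const indicator_def)
  have a: "0 \<le> a1" "a0 \<le> 1" "0 \<le> d" "d \<le> a0"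
    using f01[of x] f01[of "flip x i"] le by (auto simp: a0_def a1_def d_def)
  have u0: "0 \<le> u" using a le by (simp add: u_def)
  have u_half: "u \<le> 1/2"
    using zero_le_power2[of "2 * a0 - 1"] by (simp add: u_def power2_eq_square algebra_simps)
  have key: "l * u + c * d \<le> avg T (bd S (insert i T)) x"
    if lc: "0 \<le> l" "l \<le> 1" "0 \<le> c" and *: "\<And>h. l * real h powr beta + c \<le> real (Suc h) powr beta" for l c
  proof -
    have "l * bd S T y + c * Z y \<le> bd S (insert i T) y" for y
      using Z01[of y] *[of "out_deg S T y"] bd_Z[of y] lc bd_nonneg[of S T y]
      by (auto simp: bd_ins mult_left_le_one_le)
    then have "avg T (\<lambda>y. l * bd S T y + c * Z y) x \<le> avg T (bd S (insert i T)) x"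
      by (intro avg_mono)
    then have "l * avg T (bd S T) x + c * avg T Z x \<le> avg T (bd S (insert i T)) x"
      by (simp add: avg_add avg_cmult)
    moreover have "l * u \<le> l * avg T (bd S T) x" "c * d \<le> c * avg T Z x"
      using IH dZ lc by (auto intro!: mult_left_mono simp: u_def)
    ultimately show ?thesis by linarith
  qed
  consider "d = 0" | "u \<le> d" "d > 0" | "0 < d" "d < u" using a by linarith
  then have "u + d\<^sup>2 \<le> avg T (bd S (insert i T)) x"
  proof cases
    case 1
    have "u \<le> avg T (bd S T) x" using IH by (simp add: u_def)
    also have "\<dots> \<le> avg T (bd S (insert i T)) x"
      using T beta_ge_half by (intro avg_mono) (auto simp: bd_def out_deg_insert intro!: powr_mono2)
    finally show ?thesis using 1 by simp
  next
    case 2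
    \<comment> \<open>Since \<open>u / 2 = a0 * (1 - a0)\<close>, this is what
      \<open>u / 2 + d\<close> needs in order to reach \<open>u + d * d\<close>. As
      \<open>d \<le> a0\<close>, it holds once \<open>d = a0\<close> or
      \<open>d \<ge> 1 - a0\<close>, and \<open>u \<le> d\<close> forces one of the two.\<close>
    have "a0 * (1 - a0) \<le> d * (1 - d)"
    proof -
      have "d = a0 \<or> 1 \<le> a0 + d"
      proof (cases "a0 \<le> 1/2")
        case True
        then have "a0 * 1 \<le> a0 * (2 * (1 - a0))" using a by (intro mult_left_mono) auto
        then have "a0 \<le> u" unfolding u_def by linarith
        then have "d = a0" using 2 a by simp
        then show ?thesis by simp
      next
        case False
        have "(1 - a0) * 1 \<le> (1 - a0) * (2 * a0)" using False a by (intro mult_left_mono) auto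
        then show ?thesis using 2 a by (simp add: u_def algebra_simps)
      qed
      then have "0 \<le> (a0 - d) * (a0 + d - 1)"
        using a by auto
      then show ?thesis by (simp add: algebra_simps)
    qed
    moreover have "1/2 * u + 1 * d \<le> avg T (bd S (insert i T)) x"
      using Suc_powr_beta_ge_half by (intro key) (auto simp: add.commute)
    ultimately show ?thesis by (simp add: u_def power2_eq_square algebra_simps)
  next
    case 3
    define r where "r = d / u"
    define s where "s = r powr (1 / beta)"
    define w where "w = 1 / (1 + s)"
    have r: "0 < r" "r \<le> 1" using 3 by (auto simp: r_def)
    have s: "0 < s" "s \<le> 1" "s powr beta = r"
      using r beta_ge_half by (auto simp: s_def powr_powr powr_le1)
    have w: "0 < w" "w < 1" using s by (auto simp: w_def field_simps)
    have "w powr (1 - beta) * u + (1 - w) powr (1 - beta) * d \<le> avg T (bd S (insert i T)) x"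
      using w Suc_powr_beta_ge[OF w] beta_le by (intro key) (auto simp: powr_le1)
    moreover have "w powr (1 - beta) * u + (1 - w) powr (1 - beta) * d = u * (1 + s) powr beta"
    proof -
      have "1 - w = s / (1 + s)" using s by (simp add: w_def field_simps)
      then have 1: "(1 - w) powr (1 - beta) = (s / r) * ((1 + s) powr beta / (1 + s))"
        using s by (simp add: powr_divide powr_diff)
      have 2: "w powr (1 - beta) = (1 + s) powr beta / (1 + s)"
        using s by (simp add: w_def powr_divide powr_diff)
      have d: "d = u * r" using 3 by (simp add: r_def)
      have "w powr (1 - beta) * u + (1 - w) powr (1 - beta) * d = (1 + s) powr beta / (1 + s) * u * (1 + s)"
        unfolding 1 2 d distrib_left[of _ 1 s] using r by simp
      then show ?thesis using s by simp
    qed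
    \<comment> \<open>With \<open>d = u * r\<close>, the gain \<open>u * (r\<^sup>2 / 2)\<close>
      covers \<open>d\<^sup>2\<close> because \<open>u \<le> 1/2\<close>.\<close>
    moreover have "u * (1 + r\<^sup>2 / 2) \<le> u * (1 + s) powr beta"
      using one_plus_powr_beta_ge[of s] s u0 by (intro mult_left_mono) auto
    moreover have "d\<^sup>2 \<le> u * (r\<^sup>2 / 2)"
    proof -
      have d: "d = u * r" using 3 by (simp add: r_def)
      have "d\<^sup>2 = u * (u * r\<^sup>2)" unfolding d by (simp add: power2_eq_square)
      also have "\<dots> \<le> u * (1/2 * r\<^sup>2)" using u0 u_half by (intro mult_left_mono mult_right_mono) auto
      finally show ?thesis by simp
    qed
    ultimately show ?thesis by (simp add: algebra_simps)
  qed
  then show ?thesis by (simp add: u_def d_def)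
qed

text \<open>Split along the new direction. The denser half gains the square of the density
  difference from the edges across; on the sparser half monotonicity of \<open>bd\<close> in
  \<open>T\<close> suffices. That gain is exactly what turns the sum of the two quadratic bounds
  into the bound at the mean density.\<close>

theorem isoperimetry:
  assumes "finite T"
  shows "2 * avg T (indicator S) x * (1 - avg T (indicator S) x) \<le> avg T (bd S T) x"
  using assms
proof (induction T arbitrary: x)
  case empty
  then show ?case by (simp add: bd_def indicator_def)
next
  case (insert i T)
  have *: "4 * ((a0 + a1) / 2) * (1 - (a0 + a1) / 2) \<le> avg T (bd S (insert i T)) y + avg T (bd S (insert i T)) (flip y i)"
    if "a0 = avg T (indicator S) y" "a1 = avg T (indicator S) (flip y i)" "a1 \<le> a0" for y a0 a1
  proof -
    have "2 * a0 * (1 - a0) + (a0 - a1)\<^sup>2 \<le> avg T (bd S (insert i T)) y"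
      using that insert by (auto intro: avg_bd_insert_ge)
    moreover have "2 * a1 * (1 - a1) \<le> avg T (bd S T) (flip y i)"
      using that insert by auto
    moreover have "avg T (bd S T) (flip y i) \<le> avg T (bd S (insert i T)) (flip y i)"
      using insert beta_ge_half by (intro avg_mono) (auto simp: bd_def out_deg_insert intro!: powr_mono2)
    moreover have "4 * ((a0 + a1) / 2) * (1 - (a0 + a1) / 2)
        = 2 * a0 * (1 - a0) + (a0 - a1)\<^sup>2 + 2 * a1 * (1 - a1)"
      by (simp add: power2_eq_square field_simps)
    ultimately show ?thesis by linarith
  qed
  define a0 a1 where "a0 = avg T (indicator S :: _ \<Rightarrow> real) x" and "a1 = avg T (indicator S :: _ \<Rightarrow> real) (flip x i)"
  have "4 * ((a0 + a1) / 2) * (1 - (a0 + a1) / 2) \<le> avg T (bd S (insert i T)) x + avg T (bd S (insert i T)) (flip x i)"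
    \<comment> \<open>Either half may be the denser one; flipping \<open>i\<close> exchanges
      them.\<close>
    using *[of a0 x a1] *[of a1 "flip x i" a0]
    by (cases "a1 \<le> a0") (simp_all add: a0_def a1_def add.commute)
  moreover define q where "q = (a0 + a1) / 2 * (1 - (a0 + a1) / 2)"
  ultimately have "2 * q \<le> (avg T (bd S (insert i T)) x + avg T (bd S (insert i T)) (flip x i)) / 2"
    unfolding mult.assoc q_def[symmetric] by simp
  then show ?case
    by (simp only: avg_insert[OF insert.hyps(1,2)] a0_def a1_def q_def mult.assoc)
qed

section \<open>Fourier analysis on the cube\<close>

definition expect :: "nat \<Rightarrow> ((nat \<Rightarrow> bool) \<Rightarrow> real) \<Rightarrow> real" where
  "expect n \<phi> = (\<Sum>x\<in>cube n. \<phi> x) / 2 ^ n"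

lemma cube_eq_image: "cube n = (\<lambda>U i. i \<in> U) ` Pow {..<n}"
proof (intro equalityI subsetI)
  fix x assume "x \<in> cube n"
  then have "{i. x i} \<subseteq> {..<n}"
    by (auto simp: cube_def) (meson not_less)
  then show "x \<in> (\<lambda>U i. i \<in> U) ` Pow {..<n}"
    by (intro image_eqI[of _ _ "{i. x i}"]) auto
qed (auto simp: cube_def)

lemma finite_cube [simp]: "finite (cube n)"
  by (simp add: cube_eq_image)

lemma card_cube [simp]: "card (cube n) = 2 ^ n"
proof -
  have "inj_on (\<lambda>U i. i \<in> U) (Pow {..<n})"
    by (rule inj_onI) (metis Collect_mem_eq)
  then show ?thesis by (simp add: cube_eq_image card_image card_Pow)
qed

lemma flip_in_cube_iff [simp]: "i < n \<Longrightarrow> flip x i \<in> cube n \<longleftrightarrow> x \<in> cube n"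
  by (auto simp: cube_def flip_def)

lemma xor_set_in_cube: "x \<in> cube n \<Longrightarrow> U \<subseteq> {..<n} \<Longrightarrow> xor_set x U \<in> cube n"
  by (auto simp: cube_def xor_set_def)

lemma expect_cong: "(\<And>x. x \<in> cube n \<Longrightarrow> \<phi> x = \<psi> x) \<Longrightarrow> expect n \<phi> = expect n \<psi>"
  unfolding expect_def by (metis sum.cong)

lemma expect_add: "expect n (\<lambda>x. \<phi> x + \<psi> x) = expect n \<phi> + expect n \<psi>"
  by (simp add: expect_def sum.distrib add_divide_distrib)

lemma expect_diff: "expect n (\<lambda>x. \<phi> x - \<psi> x) = expect n \<phi> - expect n \<psi>"
  by (simp add: expect_def sum_subtractf diff_divide_distrib)

lemma expect_cmult: "expect n (\<lambda>x. c * \<phi> x) = c * expect n \<phi>"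
  by (simp add: expect_def sum_distrib_left)

lemma expect_divide: "expect n (\<lambda>x. \<phi> x / c) = expect n \<phi> / c"
  using expect_cmult[of n "1 / c" \<phi>] by simp

lemma expect_const [simp]: "expect n (\<lambda>x. c) = c"
  by (simp add: expect_def)

lemma expect_sum: "expect n (\<lambda>x. \<Sum>i\<in>I. \<phi> i x) = (\<Sum>i\<in>I. expect n (\<phi> i))"
  unfolding expect_def by (subst sum.swap) (simp add: sum_divide_distrib)

lemma expect_mono: "(\<And>x. x \<in> cube n \<Longrightarrow> \<phi> x \<le> \<psi> x) \<Longrightarrow> expect n \<phi> \<le> expect n \<psi>"
  by (simp add: expect_def divide_right_mono sum_mono)

lemma expect_nonneg: "(\<And>x. x \<in> cube n \<Longrightarrow> 0 \<le> \<phi> x) \<Longrightarrow> 0 \<le> expect n \<phi>"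
  using expect_mono[of n "\<lambda>_. 0" \<phi>] by simp

lemma expect_indicator: "S \<subseteq> cube n \<Longrightarrow> expect n (indicator S) = mu n S"
  by (simp add: expect_def mu_def indicator_def sum.If_cases Int_absorb1)

lemma expect_flip: "i < n \<Longrightarrow> expect n (\<lambda>x. \<phi> (flip x i)) = expect n \<phi>"
  unfolding expect_def
  by (rule arg_cong[where f = "\<lambda>z. z / _"],
      rule sum.reindex_bij_witness[of _ "\<lambda>x. flip x i" "\<lambda>x. flip x i"]) auto

lemma expect_flip_mean: "i < n \<Longrightarrow> expect n \<phi> = expect n (\<lambda>x. (\<phi> x + \<phi> (flip x i)) / 2)"
  by (simp add: expect_divide expect_add expect_flip)

lemma expect_odd:
  assumes "i < n" "\<And>x. \<phi> (flip x i) = - \<phi> x"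
  shows "expect n \<phi> = 0"
  using expect_flip_mean[OF assms(1), of \<phi>] by (simp add: assms(2))

lemma expect_avg:
  assumes "finite T" "T \<subseteq> {..<n}"
  shows "expect n (avg T \<phi>) = expect n \<phi>"
  using assms
proof (induction T)
  case (insert i T)
  then have "avg (insert i T) \<phi> = (\<lambda>x. (avg T \<phi> x + avg T \<phi> (flip x i)) / 2)"
    by (intro ext avg_insert)
  then show ?case using insert expect_flip_mean[of i n "avg T \<phi>"] by simp
qed (simp add: expect_def)

definition antipode :: "nat \<Rightarrow> (nat \<Rightarrow> bool) \<Rightarrow> nat \<Rightarrow> bool" where
  "antipode n x = (\<lambda>i. i < n \<and> \<not> x i)"

lemma antipode_in_cube: "antipode n x \<in> cube n"
  by (auto simp: cube_def antipode_def)

lemma antipode_antipode: "x \<in> cube n \<Longrightarrow> antipode n (antipode n x) = x"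
  by (auto simp: cube_def antipode_def fun_eq_iff) (meson not_less)

lemma expect_antipode: "expect n (\<lambda>x. \<phi> (antipode n x)) = expect n \<phi>"
  unfolding expect_def
  by (rule arg_cong[where f = "\<lambda>z. z / _"],
      rule sum.reindex_bij_witness[of _ "antipode n" "antipode n"])
     (auto simp: antipode_in_cube antipode_antipode)

section \<open>Characters and Fourier coefficients\<close>

definition sg :: "nat \<Rightarrow> (nat \<Rightarrow> bool) \<Rightarrow> real" where
  "sg i x = (if x i then -1 else 1)"

lemma sg_square [simp]: "sg i x * sg i x = 1" "(sg i x)\<^sup>2 = 1"
  by (auto simp: sg_def)

lemma sg_flip: "sg i (flip x j) = (if i = j then - sg i x else sg i x)"
  by (auto simp: sg_def flip_def)

lemma sg_antipode: "i < n \<Longrightarrow> sg i (antipode n x) = - sg i x"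
  by (simp add: sg_def antipode_def)

definition chi :: "nat set \<Rightarrow> (nat \<Rightarrow> bool) \<Rightarrow> real" where
  "chi U x = (\<Prod>i\<in>U. sg i x)"

lemma chi_empty [simp]: "chi {} x = 1" and chi_singleton [simp]: "chi {i} x = sg i x"
  by (simp_all add: chi_def)

lemma chi_square [simp]: "chi U x * chi U x = 1"
  by (simp add: chi_def flip: prod.distrib)

lemma chi_flip:
  assumes "finite U"
  shows "chi U (flip x i) = (if i \<in> U then - chi U x else chi U x)"
proof (cases "i \<in> U")
  case True
  then show ?thesis
    using assms by (simp add: chi_def prod.remove sg_flip)
next
  case False
  then show ?thesis by (auto simp: chi_def sg_flip intro!: prod.cong)
qed

lemma expect_chi_chi:
  assumes "U \<subseteq> {..<n}" "V \<subseteq> {..<n}"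
  shows "expect n (\<lambda>x. chi U x * chi V x) = (if U = V then 1 else 0)"
proof (cases "U = V")
  case False
  then obtain i where i: "i \<in> U \<longleftrightarrow> i \<notin> V" by auto
  have "finite U" "finite V" using assms finite_subset by auto
  moreover have "i < n" using i assms by auto
  ultimately show ?thesis
    using i False by (subst expect_odd[of i]) (auto simp: chi_flip)
qed simp

text \<open>Averaging over a direction in \<open>U\<close> cancels the character; any other
  direction leaves it unchanged.\<close>

lemma avg_chi:
  assumes "finite T" "finite U"
  shows "avg T (chi U) x = (if U \<inter> T = {} then chi U x else 0)"
  using assms(1)
proof (induction T arbitrary: x)
  case (insert i T)
  then show ?case using assms(2) by (auto simp: avg_insert chi_flip)
qed simp

definition coef :: "nat \<Rightarrow> ((nat \<Rightarrow> bool) \<Rightarrow> real) \<Rightarrow> nat set \<Rightarrow> real" where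
  "coef n \<phi> U = expect n (\<lambda>x. \<phi> x * chi U x)"

lemma coef_empty: "coef n \<phi> {} = expect n \<phi>"
  by (simp add: coef_def)

text \<open>The sum factors over the coordinates, and a coordinate where \<open>x\<close> and
  \<open>y\<close> differ contributes the factor 0.\<close>

lemma sum_chi_chi:
  assumes "x \<in> cube n" "y \<in> cube n"
  shows "(\<Sum>U\<in>Pow {..<n}. chi U y * chi U x) = (if y = x then 2 ^ n else 0)"
proof -
  have "(\<Sum>U\<in>Pow {..<n}. chi U y * chi U x) = (\<Prod>i<n. sg i y * sg i x + 1)"
    by (simp add: prod_add chi_def prod.distrib)
  also have "\<dots> = (if y = x then 2 ^ n else 0)"
  proof (cases "y = x")
    case False
    then obtain i where i: "y i \<noteq> x i" by auto
    then have "i < n" using assms by (auto simp: cube_def) (meson not_less)+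
    moreover have "sg i y * sg i x + 1 = 0" using i by (simp add: sg_def)
    ultimately show ?thesis using False by auto
  qed simp
  finally show ?thesis .
qed

lemma fourier_inversion:
  assumes "x \<in> cube n"
  shows "(\<Sum>U\<in>Pow {..<n}. coef n \<phi> U * chi U x) = \<phi> x"
proof -
  have "(\<Sum>U\<in>Pow {..<n}. coef n \<phi> U * chi U x)
      = (\<Sum>U\<in>Pow {..<n}. \<Sum>y\<in>cube n. \<phi> y * (chi U y * chi U x)) / 2 ^ n"
    by (simp add: coef_def expect_def sum_distrib_right sum_divide_distrib mult.assoc)
  also have "\<dots> = (\<Sum>y\<in>cube n. \<phi> y * (\<Sum>U\<in>Pow {..<n}. chi U y * chi U x)) / 2 ^ n"
    by (subst sum.swap) (simp add: sum_distrib_left)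
  also have "\<dots> = (\<Sum>y\<in>cube n. if y = x then \<phi> y * 2 ^ n else 0) / 2 ^ n"
    using assms by (intro arg_cong[where f = "\<lambda>z. z / _"] sum.cong) (auto simp: sum_chi_chi)
  finally show ?thesis using assms by simp
qed

lemma avg_fourier:
  assumes "x \<in> cube n" "T \<subseteq> {..<n}"
  shows "avg T \<phi> x = (\<Sum>U | U \<subseteq> {..<n} \<and> U \<inter> T = {}. coef n \<phi> U * chi U x)"
proof -
  have T: "finite T" using assms finite_subset by auto
  have "avg T \<phi> x = avg T (\<lambda>y. \<Sum>U\<in>Pow {..<n}. coef n \<phi> U * chi U y) x"
    unfolding avg_def using assms
    by (intro arg_cong[where f = "\<lambda>z. z / _"] sum.cong refl fourier_inversion[symmetric] xor_set_in_cube) auto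
  also have "\<dots> = (\<Sum>U\<in>Pow {..<n}. avg T (\<lambda>y. coef n \<phi> U * chi U y) x)"
    unfolding avg_def by (subst sum.swap) (simp add: sum_divide_distrib)
  also have "\<dots> = (\<Sum>U\<in>Pow {..<n}. if U \<inter> T = {} then coef n \<phi> U * chi U x else 0)"
    using T by (intro sum.cong refl, subst avg_cmult, subst avg_chi) (auto intro: finite_subset)
  also have "\<dots> = (\<Sum>U | U \<subseteq> {..<n} \<and> U \<inter> T = {}. coef n \<phi> U * chi U x)"
    by (subst sum.inter_filter[symmetric]) (auto intro!: sum.cong)
  finally show ?thesis .
qed

lemma parseval_avg:
  assumes "T \<subseteq> {..<n}"
  shows "expect n (\<lambda>x. (avg T \<phi> x)\<^sup>2) = (\<Sum>U | U \<subseteq> {..<n} \<and> U \<inter> T = {}. (coef n \<phi> U)\<^sup>2)"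
proof -
  define F where "F = {U. U \<subseteq> {..<n} \<and> U \<inter> T = {}}"
  have F: "finite F" unfolding F_def by (rule finite_subset[of _ "Pow {..<n}"]) auto
  have "expect n (\<lambda>x. (avg T \<phi> x)\<^sup>2)
      = expect n (\<lambda>x. \<Sum>U\<in>F. \<Sum>V\<in>F. (coef n \<phi> U * coef n \<phi> V) * (chi U x * chi V x))"
    using assms by (intro expect_cong)
      (simp add: avg_fourier F_def[symmetric] power2_eq_square sum_product mult_ac)
  also have "\<dots> = (\<Sum>U\<in>F. \<Sum>V\<in>F. if V = U then coef n \<phi> U * coef n \<phi> V else 0)"
    unfolding expect_sum expect_cmult by (intro sum.cong refl) (auto simp: F_def expect_chi_chi)
  also have "\<dots> = (\<Sum>U\<in>F. (coef n \<phi> U)\<^sup>2)"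
    using F by (simp add: power2_eq_square)
  finally show ?thesis by (simp add: F_def)
qed

lemma parseval: "expect n (\<lambda>x. (\<phi> x)\<^sup>2) = (\<Sum>U\<in>Pow {..<n}. (coef n \<phi> U)\<^sup>2)"
  using parseval_avg[of "{}" n \<phi>] by (simp add: Pow_def)

text \<open>\<open>isoperimetry\<close> integrated over the cube: by Parseval the squared densities
  become the Fourier weight on sets avoiding \<open>T\<close>, so the choice of \<open>T\<close>
  selects which coefficients enter.\<close>

lemma isoperimetry_expect:
  assumes T: "T \<subseteq> {..<n}" and S: "S \<subseteq> cube n"
  shows "2 * mu n S - 2 * (\<Sum>U | U \<subseteq> {..<n} \<and> U \<inter> T = {}. (coef n (indicator S) U)\<^sup>2) \<le> expect n (bd S T)"
proof -
  have fin: "finite T" using T finite_subset by auto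
  define g where "g = avg T (indicator S :: _ \<Rightarrow> real)"
  have "expect n (\<lambda>x. 2 * g x - 2 * (g x)\<^sup>2) \<le> expect n (avg T (bd S T))"
    using isoperimetry[OF fin, of S] by (intro expect_mono) (simp add: g_def power2_eq_square algebra_simps)
  then show ?thesis
    using T S fin unfolding g_def
    by (simp only: expect_diff expect_cmult expect_avg parseval_avg expect_indicator)
qed

section \<open>Moments of linear forms\<close>

definition lin :: "(nat \<Rightarrow> real) \<Rightarrow> nat set \<Rightarrow> (nat \<Rightarrow> bool) \<Rightarrow> real" where
  "lin c J x = (\<Sum>i\<in>J. c i * sg i x)"

lemma lin_insert: "finite J \<Longrightarrow> i \<notin> J \<Longrightarrow> lin c (insert i J) x = lin c J x + c i * sg i x"
  by (simp add: lin_def)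

lemma lin_flip: "i \<notin> J \<Longrightarrow> lin c J (flip x i) = lin c J x"
  unfolding lin_def by (rule sum.cong) (auto simp: sg_flip)

text \<open>Averages over the sign of the new coordinate; this is the recursion behind the three
  moments below.\<close>

lemma expect_lin_insert:
  assumes "finite J" "i \<notin> J" "i < n"
  shows "expect n (\<lambda>x. F (lin c (insert i J) x))
    = expect n (\<lambda>x. (F (lin c J x + c i) + F (lin c J x - c i)) / 2)"
proof (subst expect_flip_mean[OF assms(3)], rule expect_cong)
  fix x
  show "(F (lin c (insert i J) x) + F (lin c (insert i J) (flip x i))) / 2
      = (F (lin c J x + c i) + F (lin c J x - c i)) / 2"
    using assms by (simp add: lin_insert lin_flip sg_flip) (simp add: sg_def)
qed

lemma expect_lin_2:
  assumes "finite J" "J \<subseteq> {..<n}"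
  shows "expect n (\<lambda>x. (lin c J x)\<^sup>2) = (\<Sum>i\<in>J. (c i)\<^sup>2)"
  using assms
proof (induction J)
  case (insert i J)
  have *: "((l + d)\<^sup>2 + (l - d)\<^sup>2) / 2 = l\<^sup>2 + d\<^sup>2" for l d :: real
    by (simp add: power2_eq_square field_simps)
  show ?case using insert by (simp add: expect_lin_insert[where F = "\<lambda>z. z\<^sup>2"] * expect_add)
qed (simp add: lin_def)

lemma expect_lin_4:
  assumes "finite J" "J \<subseteq> {..<n}"
  shows "expect n (\<lambda>x. (lin c J x) ^ 4) = 3 * (\<Sum>i\<in>J. (c i)\<^sup>2)\<^sup>2 - 2 * (\<Sum>i\<in>J. (c i) ^ 4)"
  using assms
proof (induction J)
  case (insert i J)
  have *: "((l + d) ^ 4 + (l - d) ^ 4) / 2 = l ^ 4 + 6 * d\<^sup>2 * l\<^sup>2 + d ^ 4" for l d :: real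
    by (simp add: power_numeral_reduce algebra_simps)
  have **: "3 * (s + d\<^sup>2)\<^sup>2 = 3 * s\<^sup>2 + 6 * d\<^sup>2 * s + 3 * d ^ 4" for s d :: real
    by algebra
  show ?case using insert
    by (simp add: expect_lin_insert[where F = "\<lambda>z. z ^ 4"] * expect_add expect_cmult expect_lin_2)
       (simp add: add.commute[of "(c i)\<^sup>2"] **)
qed (simp add: lin_def)

text \<open>15 is the sixth moment of a standard Gaussian.\<close>

lemma expect_lin_6:
  assumes "finite J" "J \<subseteq> {..<n}"
  shows "expect n (\<lambda>x. (lin c J x) ^ 6) \<le> 15 * (\<Sum>i\<in>J. (c i)\<^sup>2) ^ 3"
  using assms
proof (induction J)
  case (insert i J)
  define s where "s = (\<Sum>i\<in>J. (c i)\<^sup>2)"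
  have *: "((l + d) ^ 6 + (l - d) ^ 6) / 2 = l ^ 6 + 15 * d\<^sup>2 * l ^ 4 + 15 * d ^ 4 * l\<^sup>2 + d ^ 6" for l d :: real
    by (simp add: power_numeral_reduce algebra_simps)
  have "expect n (\<lambda>x. (lin c (insert i J) x) ^ 6)
      = expect n (\<lambda>x. (lin c J x) ^ 6) + 15 * (c i)\<^sup>2 * expect n (\<lambda>x. (lin c J x) ^ 4)
      + 15 * (c i) ^ 4 * s + (c i) ^ 6"
    using insert by (simp add: expect_lin_insert[where F = "\<lambda>z. z ^ 6"] * expect_add expect_cmult expect_lin_2 s_def)
  \<comment> \<open>The fourth moment is at most \<open>3 * s\<^sup>2\<close>; the last two
    coefficients are raised to those of a complete cube.\<close>
  also have "\<dots> \<le> 15 * s ^ 3 + 15 * (c i)\<^sup>2 * (3 * s\<^sup>2) + 15 * (c i) ^ 4 * (3 * s) + 15 * (c i) ^ 6"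
    using insert by (intro add_mono mult_left_mono)
      (auto simp: s_def expect_lin_4 intro!: sum_nonneg mult_right_mono)
  also have "\<dots> = 15 * (s + (c i)\<^sup>2) ^ 3" by algebra
  finally show ?case using insert by (simp add: s_def add.commute)
qed (simp add: lin_def)

section \<open>Stability\<close>

lemma nat_powr_beta_le: "real h powr beta \<le> real h"
proof (cases h)
  case (Suc j)
  then have "real h powr beta \<le> real h powr 1"
    using beta_le by (intro powr_mono) auto
  then show ?thesis by simp
qed simp

text \<open>The slopes \<open>3/4\<close> and \<open>23/50\<close> lie strictly between the increments of \<open>h\<^sup>\<beta>\<close> to the left and to the right
  of \<open>h = 1\<close> and \<open>h = 2\<close>; this is what makes the deviation bound linear.\<close>

lemma powr_beta_gap_1: "\<bar>real h - 1\<bar> / 25 \<le> 1 + 3/4 * (real h - 1) - real h powr beta"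
proof -
  consider "h = 0" | "h = 1" | "2 \<le> h" by linarith
  then show ?thesis
  proof cases
    case 3
    have "real h powr beta \<le> 2 powr beta * (1 + beta * (real h / 2 - 1))"
      using beta_ge_half beta_le by (intro powr_le_tangent) auto
    also have "\<dots> \<le> 3/2 * (1 + 3/5 * (real h / 2 - 1))"
      unfolding two_powr_beta using 3 beta_le by (intro mult_left_mono add_mono mult_right_mono) auto
    finally show ?thesis using 3 by (simp add: abs_if field_simps)
  qed auto
qed

lemma powr_beta_gap_2: "\<bar>real h - 2\<bar> / 25 \<le> 3/2 + 23/50 * (real h - 2) - real h powr beta"
proof -
  consider "h = 0" | "h = 1" | "h = 2" | "3 \<le> h" by linarith
  then show ?thesis
  proof cases
    case 4
    \<comment> \<open>At \<open>h = 3\<close> the resulting bound 48/25 equals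
      \<open>3/2 + 23/50 - 1/25\<close>. The case \<open>h = 1\<close> is an equality too, which
      fixes the slope 23/50.\<close>
    have "real h powr beta \<le> 3 powr beta * (1 + beta * (real h / 3 - 1))"
      using beta_ge_half beta_le by (intro powr_le_tangent) auto
    also have "\<dots> \<le> 48/25 * (1 + 3/5 * (real h / 3 - 1))"
      using 4 beta_le beta_ge_half three_powr_beta by (intro mult_mono add_mono mult_right_mono) auto
    finally show ?thesis using 4 by (simp add: abs_if field_simps)
  qed (auto simp: two_powr_beta)
qed

text \<open>For uniformly random \<open>T\<close> the size of \<open>T \<inter> R\<close> is
  binomial; this and the next lemma compute the mean of its power. In use, \<open>R\<close> is the
  set of boundary directions at a vertex of degree \<open>k\<close>.\<close>

lemma sum_Pow_card_Int_powr_beta_1: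
  assumes "R \<subseteq> {..<n}" "card R = 1"
  shows "(\<Sum>T\<in>Pow {..<n}. real (card (T \<inter> R)) powr beta) = 2 ^ n * (1/2)"
proof -
  obtain r where R: "R = {r}" using assms by (auto simp: card_1_singleton_iff)
  have N: "{..<n} = insert r ({..<n} - {r})" using assms R by auto
  have TY: "T \<inter> {r} = {}" if "T \<in> Pow ({..<n} - {r})" for T using that by auto
  have n: "n = Suc (card ({..<n} - {r}))" using assms R by (subst card.remove[of _ r, symmetric]) auto
  have "(\<Sum>T\<in>Pow {..<n}. real (card (T \<inter> R)) powr beta)
      = (\<Sum>T\<in>Pow ({..<n} - {r}). 0) + (\<Sum>T\<in>Pow ({..<n} - {r}). 1)"
    by (subst N, subst sum_Pow_insert) (use TY in \<open>auto simp: R intro!: arg_cong2[where f = "(+)"] sum.cong sum.neutral\<close>)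
  also have "\<dots> = 2 ^ n * (1/2)"
    by (subst (3) n) (simp add: card_Pow)
  finally show ?thesis .
qed

lemma sum_Pow_card_Int_powr_beta_2:
  assumes "R \<subseteq> {..<n}" "card R = 2"
  shows "(\<Sum>T\<in>Pow {..<n}. real (card (T \<inter> R)) powr beta) = 2 ^ n * (7/8)"
proof -
  obtain r s where R: "R = {r, s}" "r \<noteq> s" using assms by (auto simp: card_2_iff)
  define Y where "Y = {..<n} - {r, s}"
  have Y: "finite Y" "r \<notin> Y" "s \<notin> Y" by (auto simp: Y_def)
  have N: "{..<n} = insert r (insert s Y)" using assms R by (auto simp: Y_def)
  have "card {..<n} = Suc (Suc (card Y))" unfolding N using R Y by simp
  then have n: "n = Suc (Suc (card Y))" by simp
  have np: "(2::real) ^ n = 4 * 2 ^ card Y" by (subst n) simp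
  have TY: "T \<inter> {r, s} = {}" "T \<inter> {s} = {}" if "T \<in> Pow Y" for T using that Y by auto
  have "(\<Sum>T\<in>Pow {..<n}. real (card (T \<inter> R)) powr beta)
      = (\<Sum>T\<in>Pow Y. real (card (T \<inter> R)) powr beta) + (\<Sum>T\<in>Pow Y. real (card (insert s T \<inter> R)) powr beta)
      + ((\<Sum>T\<in>Pow Y. real (card (insert r T \<inter> R)) powr beta) + (\<Sum>T\<in>Pow Y. real (card (insert r (insert s T) \<inter> R)) powr beta))"
    unfolding N using Y R by (simp add: sum_Pow_insert)
  \<comment> \<open>The four possible intersections with \<open>{r, s}\<close> contribute 0, 1, 1
    and 3/2, with mean 7/8.\<close>
  also have "\<dots> = (\<Sum>T\<in>Pow Y. 0) + (\<Sum>T\<in>Pow Y. 1) + ((\<Sum>T\<in>Pow Y. 1) + (\<Sum>T\<in>Pow Y. 3/2))"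
    using R TY by (intro arg_cong2[where f = "(+)"] sum.cong) (auto simp: two_powr_beta)
  also have "\<dots> = 2 ^ n * (7/8)"
    using Y np by (simp add: card_Pow)
  finally show ?thesis .
qed

text \<open>Noise stability: a random \<open>T\<close> avoids \<open>U\<close> with probability
  \<open>1 / 2 ^ card U\<close>. Replacing this by 1/4 whenever \<open>card U \<ge> 2\<close> leaves
  a quarter of the total weight plus corrections at levels 0 and 1.\<close>

lemma low_degree_bound:
  fixes n \<phi>
  defines "c \<equiv> coef n \<phi>"
  shows "(\<Sum>T\<in>Pow {..<n}. \<Sum>U | U \<subseteq> {..<n} \<and> U \<inter> T = {}. (c U)\<^sup>2)
    \<le> 2 ^ n * (expect n (\<lambda>x. (\<phi> x)\<^sup>2) / 4 + 3/4 * (c {})\<^sup>2 + (\<Sum>i<n. (c {i})\<^sup>2) / 4)"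
proof -
  have "(\<Sum>T\<in>Pow {..<n}. \<Sum>U | U \<subseteq> {..<n} \<and> U \<inter> T = {}. (c U)\<^sup>2)
      = (\<Sum>T\<in>Pow {..<n}. \<Sum>U\<in>Pow {..<n}. if U \<inter> T = {} then (c U)\<^sup>2 else 0)"
  proof (rule sum.cong[OF refl])
    fix T
    have "{U. U \<subseteq> {..<n} \<and> U \<inter> T = {}} = {U \<in> Pow {..<n}. U \<inter> T = {}}" by auto
    then show "(\<Sum>U | U \<subseteq> {..<n} \<and> U \<inter> T = {}. (c U)\<^sup>2)
      = (\<Sum>U\<in>Pow {..<n}. if U \<inter> T = {} then (c U)\<^sup>2 else 0)"
      by (simp only: sum.inter_filter finite_Pow_iff finite_lessThan)
  qed
  also have "\<dots> = (\<Sum>U\<in>Pow {..<n}. \<Sum>T\<in>Pow {..<n}. if U \<inter> T = {} then (c U)\<^sup>2 else 0)"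
    by (rule sum.swap)
  also have "\<dots> = (\<Sum>U\<in>Pow {..<n}. 2 ^ (n - card U) * (c U)\<^sup>2)"
  proof (intro sum.cong refl)
    fix U assume "U \<in> Pow {..<n}"
    then have U: "U \<subseteq> {..<n}" "finite U" by (auto intro: finite_subset)
    have "{T \<in> Pow {..<n}. U \<inter> T = {}} = Pow ({..<n} - U)" by auto
    then have "card {T \<in> Pow {..<n}. U \<inter> T = {}} = 2 ^ (n - card U)"
      using U by (simp add: card_Pow card_Diff_subset)
    then show "(\<Sum>T\<in>Pow {..<n}. if U \<inter> T = {} then (c U)\<^sup>2 else 0) = 2 ^ (n - card U) * (c U)\<^sup>2"
      by (subst sum.inter_filter[symmetric]) auto
  qed
  also have "\<dots> \<le> (\<Sum>U\<in>Pow {..<n}. 2 ^ n * ((c U)\<^sup>2 / 4 + (if U = {} then 3/4 * (c U)\<^sup>2 else 0)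
      + (if card U = 1 then (c U)\<^sup>2 / 4 else 0)))"
  proof (intro sum_mono)
    fix U assume "U \<in> Pow {..<n}"
    then have U: "U \<subseteq> {..<n}" "finite U" by (auto intro: finite_subset)
    then have le: "card U \<le> n" using card_mono[of "{..<n}" U] by simp
    have "(2::real) ^ (n - card U) \<le> 2 ^ n * (1/4 + (if U = {} then 3/4 else 0) + (if card U = 1 then 1/4 else 0))"
    proof -
      consider "card U = 0" | "card U = 1" | "2 \<le> card U" by linarith
      then show ?thesis
      proof cases
        case 2
        then show ?thesis using le by (cases n) auto
      next
        case 3
        have "(2::real) ^ (n - card U) \<le> 2 ^ (n - 2)" using 3 by (intro power_increasing) auto
        also have "\<dots> = 2 ^ n * (1/4)" using 3 le by (simp add: power_diff)
        finally show ?thesis using 3 by auto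
      qed (use U in auto)
    qed
    from mult_right_mono[OF this zero_le_power2[of "c U"]]
    show "2 ^ (n - card U) * (c U)\<^sup>2 \<le> 2 ^ n * ((c U)\<^sup>2 / 4 + (if U = {} then 3/4 * (c U)\<^sup>2 else 0)
      + (if card U = 1 then (c U)\<^sup>2 / 4 else 0))"
      by (auto simp: algebra_simps split: if_splits)
  qed
  also have "\<dots> = 2 ^ n * ((\<Sum>U\<in>Pow {..<n}. (c U)\<^sup>2) / 4 + 3/4 * (c {})\<^sup>2 
      + (\<Sum>U\<in>Pow {..<n}. if card U = 1 then (c U)\<^sup>2 / 4 else 0))"
    by (simp add: sum.distrib sum_divide_distrib flip: sum_distrib_left)
  also have "(\<Sum>U\<in>Pow {..<n}. if card U = 1 then (c U)\<^sup>2 / 4 else 0) = (\<Sum>i<n. (c {i})\<^sup>2) / 4"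
  proof -
    have "{U \<in> Pow {..<n}. card U = 1} = (\<lambda>i. {i}) ` {..<n}"
      by (auto simp: card_1_singleton_iff)
    then show ?thesis
      by (subst sum.inter_filter[symmetric]) (auto simp: sum.reindex sum_divide_distrib)
  qed
  finally show ?thesis by (simp add: c_def parseval)
qed

text \<open>Factor out \<open>l - f\<close> and apply AM-GM. The weights are lopsided because 256
  will multiply an O(e) distance in mean square, whereas the sixth moments are of constant size and
  must enter with a small factor.\<close>

lemma fourth_power_diff_le:
  fixes l f :: real
  shows "l ^ 4 - f ^ 4 \<le> 256 * (f - l)\<^sup>2 + (l ^ 6 + f ^ 6) / 128"
proof -
  define M where "M = (l + f) * (l\<^sup>2 + f\<^sup>2)"
  have "l ^ 4 - f ^ 4 = (l - f) * M" unfolding M_def by algebra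
  moreover have "(l - f) * M \<le> 256 * (f - l)\<^sup>2 + M\<^sup>2 / 1024"
    using zero_le_power2[of "16 * (l - f) - M / 32"] by (simp add: power2_eq_square field_simps)
  moreover have "M\<^sup>2 \<le> 8 * (l ^ 6 + f ^ 6)"
  proof -
    have "0 \<le> (l - f)\<^sup>2" by simp
    then have "(l + f)\<^sup>2 \<le> 2 * (l\<^sup>2 + f\<^sup>2)" unfolding power2_eq_square by (simp add: algebra_simps)
    have "M\<^sup>2 = (l + f)\<^sup>2 * (l\<^sup>2 + f\<^sup>2)\<^sup>2" by (simp add: M_def power_mult_distrib)
    also have "\<dots> \<le> (2 * (l\<^sup>2 + f\<^sup>2)) * (l\<^sup>2 + f\<^sup>2)\<^sup>2"
      by (intro mult_right_mono) (fact, simp)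
    also have "\<dots> = 8 * (l ^ 6 + f ^ 6) - 6 * (l\<^sup>2 + f\<^sup>2) * (l\<^sup>2 - f\<^sup>2)\<^sup>2" by algebra
    also have "\<dots> \<le> 8 * (l ^ 6 + f ^ 6)" by simp
    finally show ?thesis .
  qed
  ultimately show ?thesis by linarith
qed

section \<open>Measures of sets and subcubes\<close>

lemma mu_nonneg: "0 \<le> mu n S"
  by (simp add: mu_def)

lemma mu_mono: "S \<subseteq> T \<Longrightarrow> finite T \<Longrightarrow> mu n S \<le> mu n T"
  by (simp add: mu_def divide_right_mono card_mono)

lemma mu_Un_le: "mu n (S \<union> T) \<le> mu n S + mu n T"
  unfolding mu_def add_divide_distrib[symmetric]
  by (intro divide_right_mono) (use card_Un_le[of S T] in linarith, simp)

lemma mu_Un_disjoint: "finite S \<Longrightarrow> finite T \<Longrightarrow> S \<inter> T = {} \<Longrightarrow> mu n (S \<union> T) = mu n S + mu n T"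
  by (simp add: mu_def card_Un_disjoint add_divide_distrib)

lemma mu_le_1: "S \<subseteq> cube n \<Longrightarrow> mu n S \<le> 1"
  using mu_mono[of S "cube n" n] by (simp add: mu_def)

lemma mu_subcube:
  assumes "I \<subseteq> {..<n}"
  shows "mu n (subcube n I z) = 1 / 2 ^ card I"
proof -
  define F where "F = (\<lambda>U i. if i \<in> I then z i else i \<in> U)"
  have I: "finite I" using assms finite_subset by auto
  have "subcube n I z = F ` Pow ({..<n} - I)"
  proof (intro equalityI subsetI)
    fix x assume x: "x \<in> subcube n I z"
    then have "x = F {i \<in> {..<n} - I. x i}"
      using assms by (auto simp: F_def subcube_def cube_def fun_eq_iff) (meson not_less)
    then show "x \<in> F ` Pow ({..<n} - I)" by blast
  qed (use assms in \<open>auto simp: F_def subcube_def cube_def split: if_splits\<close>)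
  moreover have "inj_on F (Pow ({..<n} - I))"
  proof (rule inj_onI)
    fix U V assume UV: "U \<in> Pow ({..<n} - I)" "V \<in> Pow ({..<n} - I)" "F U = F V"
    have "i \<in> U \<longleftrightarrow> i \<in> V" for i
      using UV(1,2) fun_cong[OF UV(3), of i] by (cases "i \<in> I") (auto simp: F_def)
    then show "U = V" by auto
  qed
  ultimately have "real (card (subcube n I z)) = 2 ^ (n - card I)"
    using assms I by (simp add: card_image card_Pow card_Diff_subset)
  moreover have "card I \<le> n" using card_mono[OF _ assms] by simp
  ultimately show ?thesis by (simp add: mu_def power_diff)
qed

lemma out_deg_mono: "T \<subseteq> T' \<Longrightarrow> finite T' \<Longrightarrow> out_deg S T x \<le> out_deg S T' x"
  unfolding out_deg_def by (intro card_mono) auto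

text \<open>The hypotheses of the theorem for small \<open>e\<close>. Once \<open>e\<close> exceeds
  the threshold, the constant \<open>10 ^ 9\<close> makes the conclusion trivial.\<close>

locale near_extremal =
  fixes k n :: nat and A B W :: "(nat \<Rightarrow> bool) set" and e m :: real
  assumes k: "k = 1 \<or> k = 2" and n: "2 \<le> n" and e: "0 < e" "e \<le> 1 / 10 ^ 9"
    and m_def: "m = 1 / 2 ^ k"
    and part: "A \<union> B \<union> W = cube n" "A \<inter> B = {}" "A \<inter> W = {}" "B \<inter> W = {}"
    and mu_A: "(1 - e) * m \<le> mu n A" "mu n A \<le> (1 + e) * m"
    and mu_W: "mu n W \<le> e * real n powr (- beta)"
    and edges: "real (card (edge_boundary A B)) < (1 + e) * real k * (2 ^ n * m)"
begin

definition S where "S = A \<union> W"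

definition deg :: "(nat \<Rightarrow> bool) \<Rightarrow> nat" where "deg x = out_deg S {..<n} x"

definition dev :: "(nat \<Rightarrow> bool) \<Rightarrow> real" where
  "dev x = indicator A x * \<bar>real (deg x) - real k\<bar>"

text \<open>Good vertices: their boundary degree is that of a vertex in a subcube of codimension
  \<open>k\<close>.\<close>

definition G where "G = {x \<in> A. deg x = k}"

definition a where "a = mu n S"

definition c where "c i = coef n (indicator S) {i}"

definition level1 where "level1 = (\<Sum>i<n. (c i)\<^sup>2)"

lemma km: "(k = 1 \<and> m = 1/2) \<or> (k = 2 \<and> m = 1/4)"
  using k by (auto simp: m_def)

lemma m_bounds: "0 < m" "m \<le> 1/2" "0 \<le> e * m" "e * m \<le> e / 2"
proof -
  show "0 < m" "m \<le> 1/2" using km by auto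
  then show "0 \<le> e * m" "e * m \<le> e / 2" using e by auto
qed

text \<open>Subcubes of codimension 1 and 2 attain equality in the isoperimetric inequality.\<close>

lemma kb: "real k powr beta * m = 2 * m * (1 - m)"
  using km by (auto simp: two_powr_beta)

lemma sub: "A \<subseteq> cube n" "W \<subseteq> cube n" "S \<subseteq> cube n" "G \<subseteq> A"
  using part by (auto simp: S_def G_def)

lemma fin: "finite A" "finite W" "finite S" "finite G"
  using sub finite_subset[OF _ finite_cube] by (meson subset_trans)+

lemma mu_W_le: "mu n W \<le> e"
proof -
  have "real n powr (- beta) \<le> 1 powr (-beta)"
    using n beta_ge_half by (intro powr_mono2') auto
  then have "e * real n powr (- beta) \<le> e * 1" using e by (intro mult_left_mono) auto
  then show ?thesis using mu_W by simp
qed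

text \<open>The exponent in the bound on \<open>W\<close> is matched to this: degrees are at most
  \<open>n\<close>, so \<open>W\<close> adds at most \<open>e\<close> to the mean of
  \<open>bd\<close>.\<close>

lemma powr_mu_W_le: "real n powr beta * mu n W \<le> e"
proof -
  have "real n powr beta * mu n W \<le> real n powr beta * (e * real n powr (- beta))"
    using mu_W by (intro mult_left_mono) auto
  also have "\<dots> = e" using n by (simp add: powr_minus)
  finally show ?thesis .
qed

lemma a_bounds: "m - 2 * e \<le> a" "a \<le> m + 2 * e"
proof -
  have "a = mu n A + mu n W"
    unfolding a_def S_def using part fin by (intro mu_Un_disjoint) auto
  then show "m - 2 * e \<le> a" "a \<le> m + 2 * e"
    using mu_A[unfolded distrib_right left_diff_distrib] mu_W_le mu_nonneg[of n W] m_bounds e by linarith+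
qed

lemma variance_ge: "m * (1 - m) - 2 * e \<le> a * (1 - a)"
proof -
  have "\<bar>(a - m) * (1 - a - m)\<bar> \<le> (2 * e) * 1"
    unfolding abs_mult using a_bounds km e by (intro mult_mono) auto
  moreover have "(a - m) * (1 - a - m) = a * (1 - a) - m * (1 - m)"
    by algebra
  ultimately show ?thesis by linarith
qed

lemma coef_empty_eq: "coef n (indicator S) {} = a"
  using sub by (simp add: coef_empty expect_indicator a_def)

lemma deg_le: "deg x \<le> n"
  unfolding deg_def out_deg_def
  by (rule order_trans[OF card_mono[of "{..<n}"]]) auto

lemma bd_le_powr_n: "T \<subseteq> {..<n} \<Longrightarrow> bd S T x \<le> real n powr beta"
  using out_deg_mono[of T "{..<n}" S x] deg_le[of x] beta_ge_half
  by (auto simp: bd_def deg_def intro!: powr_mono2)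

section \<open>Concentration of the boundary degree\<close>

lemma sum_deg_le: "(\<Sum>x\<in>A. deg x) \<le> card (edge_boundary A B)"
proof -
  define P where "P = (SIGMA x:A. {i \<in> {..<n}. flip x i \<notin> S})"
  have "edge_boundary A B \<subseteq> cube n \<times> cube n"
    using part by (auto simp: edge_boundary_def)
  then have "finite (edge_boundary A B)" by (rule finite_subset) simp
  moreover have "inj_on (\<lambda>(x, i). (x, flip x i)) P"
    by (auto simp: inj_on_def flip_def fun_eq_iff) metis
  moreover have "(\<lambda>(x, i). (x, flip x i)) ` P \<subseteq> edge_boundary A B"
  proof clarify
    fix x i assume "(x, i) \<in> P"
    then have xi: "x \<in> A" "i < n" "flip x i \<notin> S" by (auto simp: P_def)
    then have "flip x i \<in> cube n" using sub by auto
    then have "flip x i \<in> B" using xi part by (auto simp: S_def)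
    moreover have "{j. x j \<noteq> flip x i j} = {i}" by (auto simp: flip_def)
    ultimately show "(x, flip x i) \<in> edge_boundary A B"
      using xi by (simp add: edge_boundary_def adjacent_def)
  qed
  ultimately have "card P \<le> card (edge_boundary A B)"
    by (intro card_inj_on_le)
  moreover have "card P = (\<Sum>x\<in>A. deg x)"
    unfolding P_def using fin by (simp add: card_SigmaI deg_def out_deg_def)
  ultimately show ?thesis by simp
qed

lemma expect_deg_le: "expect n (\<lambda>x. indicator A x * real (deg x)) \<le> (1 + e) * real k * m"
proof -
  have "(\<Sum>x\<in>cube n. indicator A x * real (deg x)) = real (\<Sum>x\<in>A. deg x)"
    using sub by (simp add: indicator_def if_distrib[of "\<lambda>z. z * _"] sum.If_cases Int_absorb1 cong: if_cong)
  also have "\<dots> \<le> (1 + e) * real k * (2 ^ n * m)"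
    using sum_deg_le edges by linarith
  finally show ?thesis by (simp add: expect_def field_simps)
qed

text \<open>Isoperimetry bounds the mean of the \<open>beta\<close>-th power of the degree from
  below, the edge count bounds the mean degree from above, and the gap lemmas charge each deviation
  from \<open>k\<close> to the difference.\<close>

lemma expect_dev: "expect n dev \<le> 150 * e"
proof -
  \<comment> \<open>\<open>s\<close> and \<open>b\<close> are the slope and the value at
    \<open>k\<close> of the supporting lines in the gap lemmas.\<close>
  define s :: real where "s = (if k = 1 then 3/4 else 23/50)"
  define b where "b = real k powr beta"
  have b: "b = (if k = 1 then 1 else 3/2)" using k by (auto simp: b_def two_powr_beta)
  have "2 * a - 2 * a\<^sup>2 \<le> expect n (bd S {..<n})"
  proof -
    have "{U. U \<subseteq> {..<n} \<and> U \<inter> {..<n} = {}} = {{}}" by auto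
    then show ?thesis
      using isoperimetry_expect[of "{..<n}" n S] sub by (simp add: a_def[symmetric] coef_empty_eq)
  qed
  also have "\<dots> \<le> expect n (\<lambda>x. indicator A x * real (deg x) powr beta + real n powr beta * indicator W x)"
  proof (intro expect_mono)
    fix x
    show "bd S {..<n} x \<le> indicator A x * real (deg x) powr beta + real n powr beta * indicator W x"
      using bd_le_powr_n[of "{..<n}" x] by (cases "x \<in> A"; cases "x \<in> W") (auto simp: bd_def S_def deg_def)
  qed
  also have "\<dots> = expect n (\<lambda>x. indicator A x * real (deg x) powr beta) + real n powr beta * mu n W"
    using sub by (simp add: expect_add expect_cmult expect_indicator)
  finally have 1: "2 * m * (1 - m) - 5 * e \<le> expect n (\<lambda>x. indicator A x * real (deg x) powr beta)"
    using powr_mu_W_le variance_ge by (simp add: power2_eq_square algebra_simps)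
  have "dev x / 25 \<le> (b - s * real k) * indicator A x + s * (indicator A x * real (deg x))
      - indicator A x * real (deg x) powr beta" for x
  proof (cases "x \<in> A")
    case True
    have "\<bar>real (deg x) - real k\<bar> / 25 \<le> b + s * (real (deg x) - real k) - real (deg x) powr beta"
      using k powr_beta_gap_1[of "deg x"] powr_beta_gap_2[of "deg x"]
      by (elim disjE) (simp_all add: b s_def)
    then show ?thesis using True by (simp add: dev_def algebra_simps)
  qed (simp add: dev_def)
  then have "expect n (\<lambda>x. dev x / 25) \<le> expect n (\<lambda>x. (b - s * real k) * indicator A x + s * (indicator A x * real (deg x))
      - indicator A x * real (deg x) powr beta)"
    by (intro expect_mono)
  also have "\<dots> = (b - s * real k) * mu n A + s * expect n (\<lambda>x. indicator A x * real (deg x))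
      - expect n (\<lambda>x. indicator A x * real (deg x) powr beta)"
    using sub by (simp add: expect_add expect_diff expect_cmult expect_indicator)
  \<comment> \<open>The coefficient \<open>b - s * real k\<close> is positive, so the upper bound on
    \<open>mu n A\<close> applies. The terms in \<open>s\<close> then cancel, and \<open>kb\<close>
    removes everything of order 1.\<close>
  also have "\<dots> \<le> (b - s * real k) * ((1 + e) * m) + s * ((1 + e) * real k * m) - (2 * m * (1 - m) - 5 * e)"
    using mu_A expect_deg_le 1 k by (intro diff_mono add_mono mult_left_mono) (auto simp: s_def b)
  also have "\<dots> = b * m * e + (b * m - 2 * m * (1 - m)) + 5 * e" by (simp add: algebra_simps)
  also have "\<dots> \<le> 6 * e"
  proof -
    have "b * m = 2 * m * (1 - m)" using kb by (simp add: b_def)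
    moreover have "b * m * e \<le> 1 * e"
      using km e by (intro mult_right_mono) (auto simp: b)
    ultimately show ?thesis by linarith
  qed
  finally show ?thesis by (simp add: expect_divide)
qed

text \<open>Up to O(e) only good vertices matter: the rest of \<open>A\<close> is charged to
  \<open>dev\<close>, and \<open>W\<close> to \<open>powr_mu_W_le\<close>.\<close>

lemma expect_bd_le:
  assumes "T \<subseteq> {..<n}"
  shows "expect n (bd S T) \<le> expect n (\<lambda>x. indicator G x * bd S T x) + 451 * e"
proof -
  have "bd S T x \<le> indicator G x * bd S T x + 3 * dev x + real n powr beta * indicator W x" for x
  proof -
    consider "x \<notin> S" | "x \<in> W" | "x \<in> G" | "x \<in> A" "x \<notin> G" by (auto simp: S_def)
    then show ?thesis
    proof cases
      case 2
      then have "x \<notin> A" "x \<notin> G" using part by (auto simp: G_def)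
      then show ?thesis using 2 bd_le_powr_n[OF assms, of x]
        by (simp add: dev_def)
    next
      case 4
      have "bd S T x \<le> real (out_deg S T x)"
        using nat_powr_beta_le by (auto simp: bd_def)
      also have "\<dots> \<le> real (deg x)"
        using assms out_deg_mono[of T "{..<n}" S x] by (simp add: deg_def)
      \<comment> \<open>Off \<open>G\<close> the deviation is at least 1, and
        \<open>k \<le> 2\<close>, so the degree is at most three times the deviation.\<close>
      also have "real (deg x) \<le> 3 * dev x"
      proof -
        have "deg x \<noteq> k" using 4 by (auto simp: G_def)
        then have "\<bar>real (deg x) - real k\<bar> \<ge> 1" by linarith
        then show ?thesis using 4 k by (auto simp: dev_def abs_if split: if_splits)
      qed
      finally have "bd S T x \<le> 3 * dev x" .
      moreover have "0 \<le> real n powr beta * indicator W x" by (simp add: indicator_def)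
      ultimately have "bd S T x \<le> 3 * dev x + real n powr beta * indicator W x" by linarith
      then show ?thesis using 4(2) by simp
    qed (auto simp: bd_def dev_def indicator_def)
  qed
  then have "expect n (bd S T) \<le> expect n (\<lambda>x. indicator G x * bd S T x + 3 * dev x + real n powr beta * indicator W x)"
    by (intro expect_mono)
  also have "\<dots> = expect n (\<lambda>x. indicator G x * bd S T x) + 3 * expect n dev + real n powr beta * mu n W"
    using sub by (simp add: expect_add expect_cmult expect_indicator)
  finally show ?thesis using expect_dev powr_mu_W_le by simp
qed

lemma mu_bad: "mu n (S - G) \<le> 151 * e"
proof -
  have "indicator (S - G) x \<le> dev x + indicator W x" for x
  proof (cases "x \<in> A \<and> x \<notin> G")
    case True
    then have "deg x \<noteq> k" by (auto simp: G_def)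
    then have "\<bar>real (deg x) - real k\<bar> \<ge> 1" by linarith
    then show ?thesis using True by (auto simp: dev_def indicator_def)
  qed (auto simp: dev_def indicator_def S_def)
  then have "expect n (indicator (S - G)) \<le> expect n (\<lambda>x. dev x + indicator W x)"
    by (intro expect_mono)
  also have "\<dots> = expect n dev + mu n W" using sub by (simp add: expect_add expect_indicator)
  finally show ?thesis using sub expect_dev mu_W_le by (subst (asm) expect_indicator) auto
qed

lemma mu_G: "mu n G \<le> (1 + e) * m"
  using mu_mono[of G A n] sub fin mu_A by simp

text \<open>Sum \<open>isoperimetry_expect\<close> over all \<open>T\<close>. Good vertices
  contribute the binomial mean \<open>b\<close> to the right side, and
  \<open>low_degree_bound\<close> leaves \<open>level1\<close> as the only unknown on the
  left.\<close>

lemma level1_ge: "m / 2 - 909 * e \<le> level1"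
proof -
  define b :: real where "b = (if k = 1 then 1/2 else 7/8)"
  have avg_G: "(\<Sum>T\<in>Pow {..<n}. bd S T x) = 2 ^ n * b" if "x \<in> G" for x
  proof -
    define R where "R = {i \<in> {..<n}. flip x i \<notin> S}"
    have R: "R \<subseteq> {..<n}" "card R = k" using that by (auto simp: R_def G_def deg_def out_deg_def)
    have "bd S T x = real (card (T \<inter> R)) powr beta" if "T \<in> Pow {..<n}" for T
    proof -
      have "{i \<in> T. flip x i \<notin> S} = T \<inter> R" using that by (auto simp: R_def)
      then show ?thesis using \<open>x \<in> G\<close> by (auto simp: bd_def out_deg_def G_def S_def)
    qed
    then have "(\<Sum>T\<in>Pow {..<n}. bd S T x) = (\<Sum>T\<in>Pow {..<n}. real (card (T \<inter> R)) powr beta)"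
      by (intro sum.cong) auto
    then show ?thesis
      using R k sum_Pow_card_Int_powr_beta_1[of R n] sum_Pow_card_Int_powr_beta_2[of R n]
      by (auto simp: b_def)
  qed
  have "2 ^ n * (2 * a) - 2 * (2 ^ n * (a / 4 + 3/4 * a\<^sup>2 + level1 / 4))
      \<le> (\<Sum>T\<in>Pow {..<n}. 2 * a - 2 * (\<Sum>U | U \<subseteq> {..<n} \<and> U \<inter> T = {}. (coef n (indicator S) U)\<^sup>2))"
  proof -
    have "expect n (\<lambda>x. (indicator S x)\<^sup>2) = a"
    proof -
      have "(\<lambda>x. (indicator S x)\<^sup>2) = (indicator S :: _ \<Rightarrow> real)"
        by (auto simp: indicator_def)
      then show ?thesis using sub by (simp add: a_def expect_indicator)
    qed
    then show ?thesis
      using low_degree_bound[of n "indicator S"]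
      by (simp add: sum_subtractf card_Pow coef_empty_eq c_def level1_def flip: sum_distrib_left)
  qed
  also have "\<dots> \<le> (\<Sum>T\<in>Pow {..<n}. expect n (\<lambda>x. indicator G x * bd S T x) + 451 * e)"
  proof (rule sum_mono)
    fix T assume "T \<in> Pow {..<n}"
    then show "2 * a - 2 * (\<Sum>U | U \<subseteq> {..<n} \<and> U \<inter> T = {}. (coef n (indicator S) U)\<^sup>2)
      \<le> expect n (\<lambda>x. indicator G x * bd S T x) + 451 * e"
      using isoperimetry_expect[of T n S] expect_bd_le[of T] sub by (simp add: a_def)
  qed
  also have "\<dots> = expect n (\<lambda>x. indicator G x * (\<Sum>T\<in>Pow {..<n}. bd S T x)) + 2 ^ n * (451 * e)"
    by (simp add: sum.distrib card_Pow expect_sum sum_distrib_left)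
  also have "(\<lambda>x. indicator G x * (\<Sum>T\<in>Pow {..<n}. bd S T x)) = (\<lambda>x. 2 ^ n * b * indicator G x)"
    by (rule ext) (use avg_G in \<open>auto simp: indicator_def\<close>)
  also have "expect n (\<lambda>x. 2 ^ n * b * indicator G x) = 2 ^ n * (b * mu n G)"
    using sub by (simp add: expect_cmult expect_indicator)
  finally have "2 ^ n * (2 * a - 2 * (a / 4 + 3/4 * a\<^sup>2 + level1 / 4)) \<le> 2 ^ n * (b * mu n G + 451 * e)"
    by (simp add: algebra_simps)
  then have "2 * a - 2 * (a / 4 + 3/4 * a\<^sup>2 + level1 / 4) \<le> b * mu n G + 451 * e"
    by (simp only: mult_le_cancel_left_pos zero_less_power zero_less_numeral)
  moreover have "b * mu n G \<le> b * ((1 + e) * m)"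
    using mu_G by (intro mult_left_mono) (auto simp: b_def)
  \<comment> \<open>The term \<open>m / 4\<close> here is the source of the leading term
    \<open>m / 2\<close>; the variance terms cancel up to O(e).\<close>
  moreover have "b * ((1 + e) * m) \<le> 3/2 * (m * (1 - m)) - m / 4 + e / 4"
  proof -
    have "b = 1/2 \<and> m = 1/2 \<or> b = 7/8 \<and> m = 1/4" using km by (auto simp: b_def)
    then have "b * m = 3/2 * (m * (1 - m)) - m / 4" "b * m \<le> 1/4"
      by (elim disjE conjE; simp only:; simp)+
    moreover from this(2) have "b * m * e \<le> 1/4 * e" using e by (intro mult_right_mono) auto
    moreover have "b * ((1 + e) * m) = b * m + b * m * e" by algebra
    ultimately show ?thesis by linarith
  qed
  moreover have "2 * a - 2 * (a / 4 + 3/4 * a\<^sup>2 + level1 / 4) = 3/2 * (a * (1 - a)) - level1 / 2"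
    by (simp add: power2_eq_square algebra_simps)
  ultimately show ?thesis
    using variance_ge e by linarith
qed

end

section \<open>The odd part and its linear approximation\<close>

context near_extremal
begin

definition odd_part :: "(nat \<Rightarrow> bool) \<Rightarrow> real" where
  "odd_part x = (indicator S x - indicator S (antipode n x)) / 2"

lemma odd_part_cases: "odd_part x = 0 \<or> odd_part x = 1/2 \<or> odd_part x = -1/2"
  by (auto simp: odd_part_def indicator_def)

lemma odd_part_powers: "odd_part x ^ 4 = (odd_part x)\<^sup>2 / 4" "odd_part x ^ 6 = (odd_part x)\<^sup>2 / 16"
  using odd_part_cases[of x] by (elim disjE; simp only:; simp add: power_divide)+

lemma expect_odd_part_sq_le: "expect n (\<lambda>x. (odd_part x)\<^sup>2) \<le> a / 2"
proof -
  have "expect n (\<lambda>x. (odd_part x)\<^sup>2) \<le> expect n (\<lambda>x. (indicator S x + indicator S (antipode n x)) / 4)"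
    by (intro expect_mono) (auto simp: odd_part_def indicator_def power2_eq_square)
  also have "\<dots> = a / 2"
    using sub by (simp add: expect_divide expect_add expect_antipode expect_indicator a_def)
  finally show ?thesis .
qed

text \<open>The linear form is odd under the antipodal map, hence orthogonal to the even part of the
  indicator.\<close>

lemma expect_odd_part_lin: "expect n (\<lambda>x. odd_part x * lin c {..<n} x) = level1"
proof -
  define f :: "_ \<Rightarrow> real" where "f = indicator S"
  have lin_anti: "lin c {..<n} (antipode n x) = - lin c {..<n} x" for x
    by (simp add: lin_def sg_antipode sum_negf)
  have 1: "expect n (\<lambda>x. f x * lin c {..<n} x) = level1"
  proof -
    have "expect n (\<lambda>x. f x * lin c {..<n} x) = expect n (\<lambda>x. \<Sum>i<n. c i * (f x * sg i x))"
      by (simp add: lin_def sum_distrib_left mult_ac)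
    also have "\<dots> = level1"
      by (simp add: expect_sum expect_cmult level1_def power2_eq_square c_def coef_def f_def)
    finally show ?thesis .
  qed
  have "expect n (\<lambda>x. f (antipode n x) * lin c {..<n} x)
      = expect n (\<lambda>x. f (antipode n (antipode n x)) * lin c {..<n} (antipode n x))"
    by (rule expect_antipode[symmetric])
  also have "\<dots> = expect n (\<lambda>x. - 1 * (f x * lin c {..<n} x))"
    by (intro expect_cong) (simp add: antipode_antipode lin_anti)
  finally have "expect n (\<lambda>x. f (antipode n x) * lin c {..<n} x) = - level1"
    using 1 by (simp only: expect_cmult)
  moreover have "expect n (\<lambda>x. odd_part x * lin c {..<n} x)
      = expect n (\<lambda>x. (f x * lin c {..<n} x - f (antipode n x) * lin c {..<n} x) / 2)"
    by (intro expect_cong) (simp add: odd_part_def f_def algebra_simps)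
  ultimately show ?thesis using 1 by (simp add: expect_divide expect_diff)
qed

text \<open>The form is the projection of the odd part to degree one, so its squared norm and its
  inner product with the odd part both equal \<open>level1\<close>.\<close>

lemma expect_odd_part_minus_lin: "expect n (\<lambda>x. (odd_part x - lin c {..<n} x)\<^sup>2) \<le> a / 2 - level1"
proof -
  have "expect n (\<lambda>x. (odd_part x - lin c {..<n} x)\<^sup>2)
      = expect n (\<lambda>x. ((odd_part x)\<^sup>2 - 2 * (odd_part x * lin c {..<n} x)) + (lin c {..<n} x)\<^sup>2)"
    by (intro expect_cong) (simp add: power2_eq_square algebra_simps)
  also have "\<dots> = expect n (\<lambda>x. (odd_part x)\<^sup>2) - level1"
    by (simp only: expect_add expect_diff expect_cmult expect_odd_part_lin expect_lin_2[OF finite_lessThan subset_refl] flip: level1_def)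
  finally show ?thesis using expect_odd_part_sq_le by simp
qed

lemma level1_le: "level1 \<le> a / 2"
proof -
  have "0 \<le> expect n (\<lambda>x. (odd_part x - lin c {..<n} x)\<^sup>2)"
    by (rule expect_nonneg) simp
  then show ?thesis using expect_odd_part_minus_lin by linarith
qed

text \<open>The odd part has fourth moment at most \<open>a / 8\<close>, while a linear form with
  only small coefficients has nearly the Gaussian value \<open>3 * level1\<^sup>2\<close>. Closeness
  of the two makes the fourth powers of the coefficients account for the difference.\<close>

lemma fourth_moment:
  "3 * level1\<^sup>2 - 2 * (\<Sum>i<n. c i ^ 4) \<le> a / 8 + 256 * (a / 2 - level1) + (15 * level1 ^ 3 + a / 32) / 128"
proof -
  define l where "l = lin c {..<n}"
  have "l x ^ 4 \<le> (odd_part x)\<^sup>2 / 4 + 256 * (odd_part x - l x)\<^sup>2 + (l x ^ 6 + (odd_part x)\<^sup>2 / 16) / 128" for x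
    using fourth_power_diff_le[of "l x" "odd_part x"] unfolding odd_part_powers by linarith
  then have "expect n (\<lambda>x. l x ^ 4) \<le> expect n (\<lambda>x. (odd_part x)\<^sup>2 / 4 + 256 * (odd_part x - l x)\<^sup>2 + (l x ^ 6 + (odd_part x)\<^sup>2 / 16) / 128)"
    by (intro expect_mono)
  also have "\<dots> = expect n (\<lambda>x. (odd_part x)\<^sup>2) / 4 + 256 * expect n (\<lambda>x. (odd_part x - l x)\<^sup>2)
      + (expect n (\<lambda>x. l x ^ 6) + expect n (\<lambda>x. (odd_part x)\<^sup>2) / 16) / 128"
    by (simp only: expect_add expect_cmult expect_divide)
  also have "\<dots> \<le> (a / 2) / 4 + 256 * (a / 2 - level1) + (15 * level1 ^ 3 + (a / 2) / 16) / 128"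
    using expect_odd_part_sq_le expect_odd_part_minus_lin expect_lin_6[of "{..<n}" n c]
    by (intro add_mono divide_right_mono mult_left_mono) (auto simp: l_def level1_def)
  finally show ?thesis
    using expect_lin_4[of "{..<n}" n c] by (simp add: l_def level1_def)
qed

section \<open>Large degree-one coefficients\<close>

lemma abs_c_le: "\<bar>c i\<bar> \<le> a"
proof -
  have "\<bar>c i\<bar> \<le> expect n (indicator S)"
  proof (rule abs_leI)
    show "c i \<le> expect n (indicator S)"
      unfolding c_def coef_def by (intro expect_mono) (auto simp: indicator_def sg_def)
    have "expect n (\<lambda>x. - 1 * indicator S x) \<le> c i"
      unfolding c_def coef_def by (intro expect_mono) (auto simp: indicator_def sg_def)
    then show "- c i \<le> expect n (indicator S)" by (simp only: expect_cmult)
  qed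
  then show ?thesis using sub by (simp add: expect_indicator a_def)
qed

text \<open>If all coefficients outside \<open>I\<close> were small, fewer than \<open>k\<close>
  coefficients, each at most \<open>a\<close> in absolute value, could not lower the fourth moment
  enough for \<open>fourth_moment\<close>.\<close>

lemma exists_large_coef:
  assumes I: "I \<subseteq> {..<n}" "card I < k"
  shows "\<exists>j<n. j \<notin> I \<and> 1/20 \<le> \<bar>c j\<bar>"
proof (rule ccontr)
  assume neg: "\<not> ?thesis"
  then have small: "c j ^ 4 \<le> (c j)\<^sup>2 / 400" if "j \<in> {..<n} - I" for j
  proof -
    have "\<bar>c j\<bar> \<le> 1/20" using that neg by force
    then have "\<bar>c j\<bar>\<^sup>2 \<le> (1/20)\<^sup>2" by (intro power_mono) auto
    then have "(c j)\<^sup>2 * (c j)\<^sup>2 \<le> (1/400) * (c j)\<^sup>2"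
      by (intro mult_right_mono) (auto simp: power2_eq_square)
    then show ?thesis by (simp add: power_numeral_reduce)
  qed
  have finI: "finite I" using I finite_subset by auto
  have "(\<Sum>i<n. c i ^ 4) = (\<Sum>i\<in>{..<n} - I. c i ^ 4) + (\<Sum>i\<in>I. c i ^ 4)"
    using I by (intro sum.subset_diff) auto
  moreover have "(\<Sum>i\<in>{..<n} - I. c i ^ 4) \<le> (\<Sum>i\<in>{..<n} - I. (c i)\<^sup>2 / 400)"
    by (intro sum_mono small)
  moreover have "(\<Sum>i\<in>{..<n} - I. (c i)\<^sup>2 / 400) \<le> level1 / 400"
    unfolding level1_def sum_divide_distrib by (intro sum_mono2) auto
  moreover have "(\<Sum>i\<in>I. c i ^ 4) \<le> (\<Sum>i\<in>I. a ^ 4)"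
    using power_mono[OF abs_c_le abs_ge_zero, of _ 4] by (intro sum_mono) simp
  ultimately have upper: "(\<Sum>i<n. c i ^ 4) \<le> level1 / 400 + real (card I) * a ^ 4"
    by simp
  have level1_nonneg: "0 \<le> level1" by (simp add: level1_def sum_nonneg)
  have fm: "3 * level1\<^sup>2 - 2 * (\<Sum>i<n. c i ^ 4) \<le> a / 8 + 256 * (1 / 1000000) + (15 * level1 ^ 3 + a / 32) / 128"
    if d: "a / 2 - level1 \<le> 1 / 1000000"
  proof -
    have "256 * (a / 2 - level1) \<le> 256 * (1 / 1000000)" by (rule mult_left_mono[OF d]) simp
    then show ?thesis using fourth_moment by linarith
  qed
  from km show False
  proof (elim disjE conjE)
    \<comment> \<open>Here \<open>level1\<close> is about 1/4, so the left side of \<open>fm\<close>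
      is close to 3/16, against \<open>a / 8\<close> of about 1/16.\<close>
    assume km: "k = 1" "m = 1/2"
    then have *: "249/1000 \<le> level1" "level1 \<le> 251/1000" "a / 2 - level1 \<le> 1 / 1000000" "a \<le> 501/1000"
      using level1_ge level1_le a_bounds e by auto
    note fm = fm[OF *(3)]
    have "(249/1000)\<^sup>2 \<le> level1\<^sup>2" using * by (intro power_mono) auto
    then have "62/1000 \<le> level1\<^sup>2" by (simp add: power2_eq_square)
    moreover have "level1 ^ 3 \<le> (251/1000) ^ 3" using * level1_nonneg by (intro power_mono) auto
    then have "level1 ^ 3 \<le> 16/1000" by (simp add: power3_eq_cube)
    moreover have "(\<Sum>i<n. c i ^ 4) \<le> level1 / 400" using upper km I by simp
    ultimately have "(15 * level1 ^ 3 + a / 32) / 128 \<le> 1/100" "2 * (\<Sum>i<n. c i ^ 4) \<le> 1/100"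
      "18/100 \<le> 3 * level1\<^sup>2" "a / 8 \<le> 7/100"
      using * by simp_all
    then show False using fm by linarith
  next
    \<comment> \<open>Here \<open>level1\<close> is about 1/8: the left side is about 3/64, less
      about 2/256 for the one coefficient that \<open>I\<close> may contain, and this still exceeds
      \<open>a / 8\<close> of about 1/32.\<close>
    assume km: "k = 2" "m = 1/4"
    then have *: "124/1000 \<le> level1" "level1 \<le> 126/1000" "a / 2 - level1 \<le> 1 / 1000000" "0 \<le> a" "a \<le> 251/1000"
      using level1_ge level1_le a_bounds e by auto
    note fm = fm[OF *(3)]
    have "(124/1000)\<^sup>2 \<le> level1\<^sup>2" using * by (intro power_mono) auto
    then have "1537/100000 \<le> level1\<^sup>2" by (simp add: power2_eq_square)
    moreover have "level1 ^ 3 \<le> (126/1000) ^ 3" using * level1_nonneg by (intro power_mono) auto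
    then have "level1 ^ 3 \<le> 21/10000" by (simp add: power3_eq_cube)
    moreover have "real (card I) * a ^ 4 \<le> 1 * (251/1000) ^ 4" using * km I by (intro mult_mono power_mono) auto
    then have "(\<Sum>i<n. c i ^ 4) \<le> level1 / 400 + 4/1000" using upper by (simp add: power_numeral_reduce)
    ultimately have "(15 * level1 ^ 3 + a / 32) / 128 \<le> 4/10000" "2 * (\<Sum>i<n. c i ^ 4) \<le> 864/100000"
      "46/1000 \<le> 3 * level1\<^sup>2" "a / 8 \<le> 315/10000"
      using * by simp_all
    then show False using fm by linarith
  qed
qed

section \<open>From large coefficients to nearly full directions\<close>

definition P where "P j = {x \<in> G. flip x j \<notin> S}"

text \<open>Pairs in direction \<open>j\<close> lying inside \<open>S\<close> cancel in
  \<open>c j\<close>; only vertices of \<open>S\<close> with a boundary edge in direction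
  \<open>j\<close> remain, and those outside \<open>G\<close> are few.\<close>

lemma abs_c_le_mu_P:
  assumes "j < n"
  shows "\<bar>c j\<bar> \<le> mu n (P j) + 151 * e"
proof -
  define Q where "Q = {x \<in> S. flip x j \<notin> S}"
  define R where "R = {x \<in> S. flip x j \<in> S}"
  have "expect n (\<lambda>x. indicator R x * sg j x) = 0"
    using assms by (intro expect_odd[of j]) (auto simp: R_def sg_flip indicator_def)
  moreover have "c j = expect n (\<lambda>x. indicator Q x * sg j x + indicator R x * sg j x)"
    unfolding c_def coef_def by (intro expect_cong) (auto simp: Q_def R_def indicator_def)
  ultimately have c: "c j = expect n (\<lambda>x. indicator Q x * sg j x)"
    by (simp add: expect_add)
  have "\<bar>c j\<bar> \<le> expect n (indicator Q)"
  proof (rule abs_leI)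
    show "c j \<le> expect n (indicator Q)"
      unfolding c by (intro expect_mono) (auto simp: indicator_def sg_def)
    have "expect n (\<lambda>x. - 1 * indicator Q x) \<le> c j"
      unfolding c by (intro expect_mono) (auto simp: indicator_def sg_def)
    then show "- c j \<le> expect n (indicator Q)" by (simp only: expect_cmult)
  qed
  also have "\<dots> = mu n Q" using sub by (intro expect_indicator) (auto simp: Q_def)
  also have "\<dots> \<le> mu n (P j \<union> (S - G))"
    using fin by (intro mu_mono) (auto simp: Q_def P_def)
  also have "\<dots> \<le> mu n (P j) + 151 * e"
    using mu_Un_le[of n "P j" "S - G"] mu_bad by linarith
  finally show ?thesis .
qed

text \<open>Isoperimetry with direction \<open>j\<close> omitted: only the coefficients of
  \<open>{}\<close> and \<open>{j}\<close> survive, and the inequality is nearly tight before the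
  omission.\<close>

lemma mu_P_le:
  assumes "j < n"
  shows "mu n (P j) / real k \<le> 2 * (c j)\<^sup>2 + 456 * e"
proof -
  define T where "T = {..<n} - {j}"
  define b where "b = real k powr beta"
  have T: "finite T" "j \<notin> T" "insert j T = {..<n}" using assms by (auto simp: T_def)
  have "2 * a - 2 * (a\<^sup>2 + (c j)\<^sup>2) \<le> expect n (bd S T)"
  proof -
    have "{U. U \<subseteq> {..<n} \<and> U \<inter> T = {}} = {{}, {j}}" using assms by (auto simp: T_def)
    then show ?thesis
      using isoperimetry_expect[of T n S] sub
      by (simp add: T_def a_def[symmetric] coef_empty_eq c_def)
  qed
  also have "\<dots> \<le> expect n (\<lambda>x. indicator G x * bd S T x) + 451 * e"
    by (intro expect_bd_le) (auto simp: T_def)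
  \<comment> \<open>At a good vertex losing a boundary direction lowers \<open>bd\<close> by the
    difference of the powers of \<open>k\<close> and \<open>k - 1\<close>, which is
    \<open>1 / k\<close> for both values of \<open>k\<close>.\<close>
  also have "expect n (\<lambda>x. indicator G x * bd S T x)
      = expect n (\<lambda>x. b * indicator G x - 1 / real k * indicator (P j) x)"
  proof (intro expect_cong)
    fix x
    show "indicator G x * bd S T x = b * indicator G x - 1 / real k * indicator (P j) x"
    proof (cases "x \<in> G")
      case True
      then have "x \<in> S" "out_deg S (insert j T) x = k"
        using T by (auto simp: G_def S_def deg_def)
      then have deg: "(if flip x j \<in> S then out_deg S T x else Suc (out_deg S T x)) = k"
        using T(1,2) by (simp add: out_deg_insert)
      show ?thesis
      proof (cases "flip x j \<in> S")
        case False
        then have "out_deg S T x = k - 1" using deg by simp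
        then show ?thesis
          using True False k \<open>x \<in> S\<close> by (auto simp: P_def bd_def b_def two_powr_beta)
      qed (use True \<open>x \<in> S\<close> deg in \<open>simp add: P_def bd_def b_def\<close>)
    qed (simp add: P_def)
  qed
  also have "\<dots> = b * mu n G - mu n (P j) / real k"
  proof -
    have "P j \<subseteq> cube n" "G \<subseteq> cube n" using sub by (auto simp: P_def)
    then show ?thesis by (simp only: expect_diff expect_cmult expect_indicator) simp
  qed
  also have "b * mu n G \<le> 2 * m * (1 - m) + e"
  proof -
    have "b * mu n G \<le> b * ((1 + e) * m)" using mu_G by (intro mult_left_mono) (auto simp: b_def)
    also have "\<dots> = b * m + e * (b * m)" by algebra
    also have "b * m = 2 * m * (1 - m)" using kb by (simp add: b_def)
    also have "e * (2 * m * (1 - m)) \<le> e * 1"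
    proof (rule mult_left_mono)
      show "2 * m * (1 - m) \<le> 1" using km by (elim disjE conjE; simp only:; simp)
    qed (use e in simp)
    finally show ?thesis by simp
  qed
  finally show ?thesis
    using variance_ge by (simp add: power2_eq_square algebra_simps)
qed

text \<open>Combining the two bounds gives \<open>q * (1 - 2 * real k * q) \<le> 1063 * e\<close>
  for \<open>q = \<bar>c j\<bar>\<close>. As \<open>q\<close> is bounded away from 0, the second
  factor is O(e), and \<open>1 / (2 * real k)\<close> equals \<open>m\<close>.\<close>

lemma large_coef:
  assumes "j < n" "1/20 \<le> \<bar>c j\<bar>"
  shows "m - 10630 * e \<le> \<bar>c j\<bar>" "m - 10781 * e \<le> mu n (P j)"
proof -
  define q where "q = \<bar>c j\<bar>"
  have q2: "(c j)\<^sup>2 = q * q" by (simp add: q_def power2_eq_square)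
  have "mu n (P j) \<le> real k * (2 * (q * q) + 456 * e)"
    using mu_P_le[OF assms(1)] k unfolding q2 by auto
  then have "q \<le> real k * (2 * (q * q) + 456 * e) + 151 * e"
    using abs_c_le_mu_P[OF assms(1)] by (simp add: q_def)
  then have "q * (1 - 2 * real k * q) \<le> 1063 * e"
    using k e by (auto simp: algebra_simps)
  moreover have "1/20 * (1 - 2 * real k * q) \<le> q * (1 - 2 * real k * q)" if "0 \<le> 1 - 2 * real k * q"
    using that assms by (intro mult_right_mono) (auto simp: q_def)
  ultimately have "1 - 2 * real k * q \<le> 21260 * e"
    using e by (cases "0 \<le> 1 - 2 * real k * q") auto
  then show *: "m - 10630 * e \<le> \<bar>c j\<bar>"
    using km e unfolding q_def by auto
  then show "m - 10781 * e \<le> mu n (P j)"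
    using abs_c_le_mu_P[OF assms(1)] by simp
qed

lemma exists_directions: "\<exists>I \<subseteq> {..<n}. card I = k \<and> (\<forall>j\<in>I. 1/20 \<le> \<bar>c j\<bar>)"
proof -
  obtain i where i: "i < n" "1/20 \<le> \<bar>c i\<bar>"
    using exists_large_coef[of "{}"] k by auto
  show ?thesis
  proof (cases "k = 1")
    case True
    then show ?thesis using i by (intro exI[of _ "{i}"]) auto
  next
    case False
    then obtain j where "j < n" "j \<noteq> i" "1/20 \<le> \<bar>c j\<bar>"
      using exists_large_coef[of "{i}"] k i by auto
    then show ?thesis using i k False by (intro exI[of _ "{i, j}"]) auto
  qed
qed

section \<open>Closeness to a subcube and size of the directional boundaries\<close>

lemma mu_outside_half:
  assumes "j < n" "1/20 \<le> \<bar>c j\<bar>"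
  shows "mu n {x \<in> S. x j \<noteq> (c j < 0)} \<le> 5316 * e"
proof -
  define s :: real where "s = (if c j < 0 then -1 else 1)"
  \<comment> \<open>On \<open>S\<close>, \<open>s * sg j x\<close> is -1 exactly in the wrong
    half-cube, so the left side is half the gap between \<open>a\<close> and
    \<open>\<bar>c j\<bar>\<close>.\<close>
  have "expect n (indicator {x \<in> S. x j \<noteq> (c j < 0)}) = expect n (\<lambda>x. (indicator S x - s * (indicator S x * sg j x)) / 2)"
    by (intro expect_cong) (auto simp: s_def sg_def indicator_def)
  also have "\<dots> = (a - s * c j) / 2"
    using sub by (simp add: expect_divide expect_diff expect_cmult expect_indicator a_def c_def coef_def)
  also have "s * c j = \<bar>c j\<bar>" by (simp add: s_def)
  finally show ?thesis
    using large_coef(1)[OF assms] a_bounds sub by (subst (asm) expect_indicator) auto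
qed

text \<open>Each of the at most two half-cubes cuts O(e) off \<open>S\<close>. Since
  \<open>C\<close> has measure \<open>m\<close> and \<open>S\<close> has nearly the same measure,
  little of \<open>C\<close> is missed either; passing from \<open>S\<close> to \<open>A\<close>
  costs only \<open>W\<close>.\<close>

lemma subcube_close:
  assumes I: "I \<subseteq> {..<n}" "card I = k" "\<And>j. j \<in> I \<Longrightarrow> 1/20 \<le> \<bar>c j\<bar>"
  defines "C \<equiv> subcube n I (\<lambda>j. c j < 0)"
  shows "mu n ((C - A) \<union> (A - C)) \<le> 21267 * e"
proof -
  define H where "H j = {x \<in> S. x j \<noteq> (c j < 0)}" for j
  have H: "mu n (H j) \<le> 5316 * e" if "j \<in> I" for j
    using that I mu_outside_half[of j] by (auto simp: H_def)
  have finC: "finite C" by (auto simp: C_def subcube_def)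
  have finH: "finite (H j)" for j using fin by (simp add: H_def)
  have "S - C = (\<Union>j\<in>I. H j)"
    using sub by (auto simp: C_def H_def subcube_def)
  moreover have "mu n (\<Union>j\<in>I. H j) \<le> 10632 * e"
    using k
  proof
    assume "k = 1"
    then obtain i where "I = {i}" using I by (auto simp: card_1_singleton_iff)
    then show ?thesis using H e by force
  next
    assume "k = 2"
    then obtain i j where "I = {i, j}" using I by (auto simp: card_2_iff)
    then show ?thesis using H[of i] H[of j] mu_Un_le[of n "H i" "H j"] by simp
  qed
  ultimately have SC: "mu n (S - C) \<le> 10632 * e" by simp
  have "a = mu n (S \<inter> C) + mu n (S - C)"
    unfolding a_def using fin by (subst mu_Un_disjoint[symmetric]) (auto intro: arg_cong[where f = "mu n"])
  moreover have "mu n C = mu n (S \<inter> C) + mu n (C - S)"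
    using finC by (subst mu_Un_disjoint[symmetric]) (auto intro: arg_cong[where f = "mu n"])
  moreover have "mu n C = m"
    unfolding C_def using I by (simp add: mu_subcube m_def)
  ultimately have CS: "mu n (C - S) \<le> 10634 * e"
    using SC a_bounds by linarith
  have "mu n ((C - A) \<union> (A - C)) \<le> mu n (((C - S) \<union> (S - C)) \<union> W)"
    using fin finC by (intro mu_mono) (auto simp: S_def)
  also have "\<dots> \<le> mu n (C - S) + mu n (S - C) + mu n W"
    using mu_Un_le[of n "(C - S) \<union> (S - C)" W] mu_Un_le[of n "C - S" "S - C"] by linarith
  finally show ?thesis using SC CS mu_W_le by linarith
qed

lemma card_dir_boundary_ge:
  assumes "j < n" "1/20 \<le> \<bar>c j\<bar>"
  shows "(1 - 10 ^ 9 * e) * (2 ^ n * m) \<le> real (card (dir_boundary A j))"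
proof -
  have "dir_boundary A j \<subseteq> (\<lambda>x. (x, flip x j)) ` A" by (auto simp: dir_boundary_def)
  then have "finite (dir_boundary A j)" using fin finite_surj by blast
  moreover have "(\<lambda>x. (x, flip x j)) ` P j \<subseteq> dir_boundary A j"
    using sub by (auto simp: dir_boundary_def P_def S_def)
  moreover have "inj_on (\<lambda>x. (x, flip x j)) (P j)" by (auto simp: inj_on_def)
  ultimately have "card (P j) \<le> card (dir_boundary A j)" by (intro card_inj_on_le)
  moreover have "(m - 10781 * e) * 2 ^ n \<le> real (card (P j))"
    using large_coef(2)[OF assms] by (simp add: mu_def field_simps)
  moreover have "(1 - 10 ^ 9 * e) * m * 2 ^ n \<le> (m - 10781 * e) * 2 ^ n"
  proof (intro mult_right_mono)
    have "10781 * e \<le> 10 ^ 9 * m * e" using km e by (intro mult_right_mono) auto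
    then show "(1 - 10 ^ 9 * e) * m \<le> m - 10781 * e" by (simp add: algebra_simps)
  qed simp
  ultimately have "(1 - 10 ^ 9 * e) * m * 2 ^ n \<le> real (card (dir_boundary A j))" by linarith
  then show ?thesis by (simp only: mult_ac)
qed

end

section \<open>Choice of the constant and conclusion\<close>

theorem theorem1p9:
  shows "\<exists>K::real. K > 0 \<and>
    (\<forall>k::nat. k \<in> {1, 2} \<longrightarrow>
     (\<forall>n::nat. n \<ge> 2 \<longrightarrow>
      (\<forall>\<epsilon>::real. \<epsilon> > 0 \<longrightarrow>
       (\<forall>A B W. A \<union> B \<union> W = cube n \<and> A \<inter> B = {} \<and> A \<inter> W = {} \<and> B \<inter> W = {}
          \<and> (1 - \<epsilon>) * 2 powr (- real k) \<le> mu n A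
          \<and> mu n A \<le> (1 + \<epsilon>) * 2 powr (- real k)
          \<and> mu n W \<le> \<epsilon> * real n powr (- log 2 (3/2))
          \<and> real (card (edge_boundary A B)) < (1 + \<epsilon>) * real k * 2 powr (real n - real k)
        \<longrightarrow>
          (\<exists>I. I \<subseteq> {0..<n} \<and> card I = k \<and>
             (\<forall>i\<in>I. real (card (dir_boundary A i)) \<ge> (1 - K * \<epsilon>) * 2 powr (real n - real k)))
          \<and> (\<exists>C. is_codim_subcube n k C \<and> mu n ((C - A) \<union> (A - C)) \<le> K * \<epsilon>)))))"
proof (intro exI[of _ "10 ^ 9"] conjI[of "(10::real) ^ 9 > 0"] allI impI)
  fix k n :: nat and \<epsilon> :: real and A B W :: "(nat \<Rightarrow> bool) set"
  assume k: "k \<in> {1, 2}" and n: "2 \<le> n" and \<epsilon>: "0 < \<epsilon>"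
    and hyp: "A \<union> B \<union> W = cube n \<and> A \<inter> B = {} \<and> A \<inter> W = {} \<and> B \<inter> W = {}
          \<and> (1 - \<epsilon>) * 2 powr (- real k) \<le> mu n A
          \<and> mu n A \<le> (1 + \<epsilon>) * 2 powr (- real k)
          \<and> mu n W \<le> \<epsilon> * real n powr (- log 2 (3/2))
          \<and> real (card (edge_boundary A B)) < (1 + \<epsilon>) * real k * 2 powr (real n - real k)"
  have m: "2 powr (- real k) = 1 / (2::real) ^ k" "2 powr (real n - real k) = 2 ^ n * (1 / (2::real) ^ k)"
    by (simp_all add: powr_minus powr_diff powr_realpow field_simps)
  show "(\<exists>I. I \<subseteq> {0..<n} \<and> card I = k \<and>
             (\<forall>i\<in>I. real (card (dir_boundary A i)) \<ge> (1 - 10 ^ 9 * \<epsilon>) * 2 powr (real n - real k)))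
          \<and> (\<exists>C. is_codim_subcube n k C \<and> mu n ((C - A) \<union> (A - C)) \<le> 10 ^ 9 * \<epsilon>)"
  proof (cases "\<epsilon> \<le> 1 / 10 ^ 9")
    case True
    interpret near_extremal k n A B W \<epsilon> "1 / 2 ^ k"
      using k n \<epsilon> True hyp by unfold_locales (auto simp: m beta_def)
    obtain I where I: "I \<subseteq> {..<n}" "card I = k" "\<And>j. j \<in> I \<Longrightarrow> 1/20 \<le> \<bar>c j\<bar>"
      using exists_directions by blast
    have "\<forall>j\<in>I. (1 - 10 ^ 9 * \<epsilon>) * 2 powr (real n - real k) \<le> real (card (dir_boundary A j))"
      using card_dir_boundary_ge I unfolding m by auto
    moreover have "is_codim_subcube n k (subcube n I (\<lambda>j. c j < 0))"
      using I by (auto simp: is_codim_subcube_def atLeast0LessThan)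
    moreover have "21267 * \<epsilon> \<le> 10 ^ 9 * \<epsilon>" using \<epsilon> by simp
    then have "mu n ((subcube n I (\<lambda>j. c j < 0) - A) \<union> (A - subcube n I (\<lambda>j. c j < 0))) \<le> 10 ^ 9 * \<epsilon>"
      using subcube_close[OF I] by (meson order_trans)
    ultimately show ?thesis
      using I unfolding atLeast0LessThan by blast
  next
    case False
    \<comment> \<open>Now \<open>10 ^ 9 * \<epsilon>\<close> exceeds 1, so the boundary bound is
      negative and the measure bound exceeds 1. Any \<open>k\<close> coordinates serve, and they
      exist because \<open>k \<le> 2 \<le> n\<close>.\<close>
    have I: "{0..<k} \<subseteq> {0..<n}" "card {0..<k} = k" using k n by auto
    have "(1 - 10 ^ 9 * \<epsilon>) * 2 powr (real n - real k) \<le> 0"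
      using False by (intro mult_nonpos_nonneg) auto
    then have "\<forall>i\<in>{0..<k}. (1 - 10 ^ 9 * \<epsilon>) * 2 powr (real n - real k) \<le> real (card (dir_boundary A i))"
      by (meson of_nat_0_le_iff order_trans)
    moreover define C where "C = subcube n {0..<k} (\<lambda>_. False)"
    have "is_codim_subcube n k C"
      using I unfolding C_def is_codim_subcube_def by blast
    moreover have "mu n ((C - A) \<union> (A - C)) \<le> 10 ^ 9 * \<epsilon>"
    proof -
      have "mu n ((C - A) \<union> (A - C)) \<le> 1"
        using hyp by (intro mu_le_1) (auto simp: C_def subcube_def)
      also have "1 \<le> 10 ^ 9 * \<epsilon>" using False by simp
      finally show ?thesis .
    qed
    ultimately show ?thesis using I by blast
  qed
qed simp

end
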